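(* Let $0<\alpha<2$. Let $(d_k)$ be an increasing sequence of positive numbers such that $d_n\approx d_{2n}$, $$\sum_{k=1}^\infty\frac{d_k^{-\alpha}}{k}=\infty\qquad\text{and}\qquad d_k\succeq(\log k)^{1/(2\alpha)}.$$ Then, for any $p\in[1,\infty)$, there exists a probability measure $\sigma$ on $\mathbb{N}$ such that for the embedding $u:\ell_p\to L_\alpha(\mathbb{N},\sigma)$, we have, $\mathbb{Q}$-almost surely, $$\mathcal{G}_n(u)\succeq d_n .$$
   Context: $f\preceq g$ (equivalently $g\succeq f$) means $\limsup f/g<\infty$; $f\approx g$ means both $f\preceq g$ and $g\preceq f$. The embedding $u$ maps a sequence $(z_k)\in\ell_p$ to the function $k\mapsto z_k$ on $\mathbb{N}$. Entropy gap: let $(S,\sigma)$ be a finite measure space (here $S=\mathbb{N}$, $E=\ell_p$) and $u:E\to L_\alpha(S,\sigma)$ a decomposed operator, i.e. $(uz)(s)=\langle z,\varphi(s)\rangle$ for a measurable $\varphi:S\to E'$ with $\int_S\|\varphi\|_{E'}^\alpha d\sigma<\infty$. On a probability space $(\Delta,\mathbb{Q})$ let $(V_j)$ be i.i.d. $S$-valued with law $\sigma/\sigma(S)$ and, independently, $(\zeta_j)$ i.i.d. standard exponential; $\Gamma_j:=\zeta_1+\dots+\zeta_j$. With $c_\alpha:=\sqrt2\left(\int_0^\infty x^{-\alpha}\sin x\,dx\right)^{-1/\alpha}(\mathbf{E}|\xi|^\alpha)^{-1/\alpha}$, $\xi$ standard normal, the random operator $v:E\to\ell_2$ associated with $u$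 is $v(z):=c_\alpha\sigma(S)^{1/\alpha}\left((uz)(V_j)\Gamma_j^{-1/\alpha}\right)_{j\ge1}$. The $n$-th entropy gap is the random variable $$\mathcal{G}_n(u):=\frac{e_n(v)}{n^{-1/\alpha+1/2}e_n(u)}.$$ Dyadic entropy numbers of an operator $w:E\to F$ (with $F$ quasi-normed): $e_n(w):=\inf\{\varepsilon>0\mid\exists y_1,\dots,y_{2^{n-1}}\in F\ \forall z\in E,\|z\|\le1\ \exists i\le2^{n-1}:\ \|w(z)-y_i\|\le\varepsilon\}$. *)

theory Defs
  imports "HOL-Probability.Probability"
begin

section \<open>Asymptotic comparison\<close>

text \<open>
  Division is taken in the extended reals, where \<open>x / 0 = \<infinity>\<close> for \<open>x > 0\<close>; in the reals
  a vanishing denominator would make the relation hold trivially.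
\<close>

definition preceq :: "(nat \<Rightarrow> ereal) \<Rightarrow> (nat \<Rightarrow> ereal) \<Rightarrow> bool" (infix "\<preceq>" 50)
  where "f \<preceq> g \<longleftrightarrow> limsup (\<lambda>n. f n / g n) < \<infinity>"

definition same_order :: "(nat \<Rightarrow> ereal) \<Rightarrow> (nat \<Rightarrow> ereal) \<Rightarrow> bool"
  where "same_order f g \<longleftrightarrow> f \<preceq> g \<and> g \<preceq> f"


section \<open>Sequence and function spaces\<close>

text \<open>
  All spaces are real. The index set of the sequence spaces is the type \<open>nat\<close>, so that
  indices start at 0.
\<close>

definition ell :: "real \<Rightarrow> (nat \<Rightarrow> real) set"
  where "ell p = {z. summable (\<lambda>k. \<bar>z k\<bar> powr p)}"

definition ell_norm :: "real \<Rightarrow> (nat \<Rightarrow> real) \<Rightarrow> real"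
  where "ell_norm p z = (\<Sum>k. \<bar>z k\<bar> powr p) powr (1 / p)"

text \<open>
  Functions are not identified when they agree almost everywhere. This does not affect entropy
  numbers, since the quasi-norm does not distinguish such functions.
\<close>

definition Lspace :: "real \<Rightarrow> 's measure \<Rightarrow> ('s \<Rightarrow> real) set"
  where "Lspace a M = {f \<in> borel_measurable M. integrable M (\<lambda>s. \<bar>f s\<bar> powr a)}"

definition Lspace_norm :: "real \<Rightarrow> 's measure \<Rightarrow> ('s \<Rightarrow> real) \<Rightarrow> real"
  where "Lspace_norm a M f = (LINT s|M. \<bar>f s\<bar> powr a) powr (1 / a)"


section \<open>Dyadic entropy numbers\<close>

text \<open>
  The infimum is extended-real valued, hence \<open>\<infinity>\<close> if the image of the unit ball is unbounded
  or not contained in \<open>F\<close>. Only \<open>n \<ge> 1\<close> is meaningful.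
\<close>

definition entropy_number ::
  "'e set \<Rightarrow> ('e \<Rightarrow> real) \<Rightarrow> ('f::minus) set \<Rightarrow> ('f \<Rightarrow> real) \<Rightarrow> ('e \<Rightarrow> 'f) \<Rightarrow> nat \<Rightarrow> ereal"
  where
  "entropy_number E normE F normF w n =
     Inf {ereal \<epsilon> | \<epsilon>. 0 < \<epsilon> \<and>
       (\<exists>y. (\<forall>i \<in> {1..2 ^ (n - 1)::nat}. y i \<in> F) \<and>
            (\<forall>z \<in> E. normE z \<le> 1 \<longrightarrow>
               w z \<in> F \<and> (\<exists>i \<in> {1..2 ^ (n - 1)}. normF (w z - y i) \<le> \<epsilon>)))}"


section \<open>The random operator and the entropy gap\<close>

text \<open>
  For \<open>\<alpha> \<le> 1\<close> the sine integral converges only conditionally; the Henstock-Kurzweil integral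
  over the half-line includes such improper integrals.
\<close>

definition c_stable :: "real \<Rightarrow> real"
  where "c_stable \<alpha> =
    sqrt 2 * (integral {0..} (\<lambda>x::real. x powr (- \<alpha>) * sin x)) powr (- 1 / \<alpha>)
           * (LINT x|density lborel std_normal_density. \<bar>x\<bar> powr \<alpha>) powr (- 1 / \<alpha>)"

text \<open>
  The variables \<open>V\<close> and \<open>\<zeta>\<close> are indexed from 0 instead of 1. The uniform measure on
  the whole space is \<open>\<sigma>\<close> divided by its total mass.
\<close>

definition random_model ::
  "'s measure \<Rightarrow> 'w measure \<Rightarrow> (nat \<Rightarrow> 'w \<Rightarrow> 's) \<Rightarrow> (nat \<Rightarrow> 'w \<Rightarrow> real) \<Rightarrow> bool"
  where
  "random_model \<sigma> Q V \<zeta> \<longleftrightarrow>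
     prob_space Q \<and>
     prob_space.indep_vars Q (\<lambda>_. \<sigma>) V UNIV \<and>
     (\<forall>j. distr Q \<sigma> (V j) = uniform_measure \<sigma> (space \<sigma>)) \<and>
     prob_space.indep_vars Q (\<lambda>_. borel) \<zeta> UNIV \<and>
     (\<forall>j. distributed Q lborel (\<zeta> j) (\<lambda>x. ennreal (exponential_density 1 x))) \<and>
     prob_space.indep_set Q
       (sets (vimage_algebra (space Q) (\<lambda>\<omega> j. V j \<omega>) (Pi\<^sub>M UNIV (\<lambda>_. \<sigma>))))
       (sets (vimage_algebra (space Q) (\<lambda>\<omega> j. \<zeta> j \<omega>) (Pi\<^sub>M UNIV (\<lambda>_. borel))))"

text \<open>Because of the index shift, \<open>arrival \<zeta> j\<close> is the sum of the first \<open>j + 1\<close> variables.\<close>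

definition arrival :: "(nat \<Rightarrow> 'w \<Rightarrow> real) \<Rightarrow> nat \<Rightarrow> 'w \<Rightarrow> real"
  where "arrival \<zeta> j \<omega> = (\<Sum>i\<le>j. \<zeta> i \<omega>)"

definition random_operator ::
  "real \<Rightarrow> 's measure \<Rightarrow> ('e \<Rightarrow> 's \<Rightarrow> real) \<Rightarrow> (nat \<Rightarrow> 'w \<Rightarrow> 's) \<Rightarrow> (nat \<Rightarrow> 'w \<Rightarrow> real)
     \<Rightarrow> 'w \<Rightarrow> 'e \<Rightarrow> nat \<Rightarrow> real"
  where
  "random_operator \<alpha> \<sigma> u V \<zeta> \<omega> z =
     (\<lambda>j. c_stable \<alpha> * measure \<sigma> (space \<sigma>) powr (1 / \<alpha>)
            * (u z (V j \<omega>) * arrival \<zeta> j \<omega> powr (- 1 / \<alpha>)))"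

definition entropy_gap ::
  "real \<Rightarrow> 'e set \<Rightarrow> ('e \<Rightarrow> real) \<Rightarrow> 's measure \<Rightarrow> ('e \<Rightarrow> 's \<Rightarrow> real)
     \<Rightarrow> (nat \<Rightarrow> 'w \<Rightarrow> 's) \<Rightarrow> (nat \<Rightarrow> 'w \<Rightarrow> real) \<Rightarrow> nat \<Rightarrow> 'w \<Rightarrow> ereal"
  where
  "entropy_gap \<alpha> E normE \<sigma> u V \<zeta> n \<omega> =
     entropy_number E normE (ell 2) (ell_norm 2) (random_operator \<alpha> \<sigma> u V \<zeta> \<omega>) n
     / (ereal (real n powr (- 1 / \<alpha> + 1 / 2))
          * entropy_number E normE (Lspace \<alpha> \<sigma>) (Lspace_norm \<alpha> \<sigma>) u n)"

text \<open>
  The embedding is decomposed by the evaluation functionals, which have norm 1 on every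
  sequence space \<open>ell p\<close>.
\<close>

definition embedding :: "(nat \<Rightarrow> real) \<Rightarrow> nat \<Rightarrow> real"
  where "embedding z = (\<lambda>k. z k)"

lemma evaluation_bound:
  assumes "p > 0" "z \<in> ell p"
  shows "\<bar>embedding z k\<bar> \<le> ell_norm p z"
proof -
  have "\<bar>z k\<bar> powr p \<le> (\<Sum>k. \<bar>z k\<bar> powr p)"
    using sum_le_suminf[of "\<lambda>k. \<bar>z k\<bar> powr p" "{k}"] assms by (simp add: ell_def)
  then have "(\<bar>z k\<bar> powr p) powr (1 / p) \<le> (\<Sum>k. \<bar>z k\<bar> powr p) powr (1 / p)"
    using assms by (intro powr_mono2) auto
  then show ?thesis
    using assms by (simp add: ell_norm_def embedding_def powr_powr)
qed

lemma embedding_in_Lspace: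
  assumes "p > 0" "a > 0" "z \<in> ell p" "finite_measure \<sigma>" "sets \<sigma> = UNIV"
  shows "embedding z \<in> Lspace a \<sigma>"
proof -
  interpret finite_measure \<sigma> by fact
  have "space \<sigma> = UNIV"
    using assms(5) sets.space_closed[of \<sigma>] by auto
  then have meas: "f \<in> borel_measurable \<sigma>" for f :: "nat \<Rightarrow> real"
    using assms(5) by (simp add: measurable_def)
  have "integrable \<sigma> (\<lambda>s. \<bar>embedding z s\<bar> powr a)"
    using evaluation_bound[OF assms(1,3)] assms(2)
    by (intro integrable_const_bound[where B = "ell_norm p z powr a"] meas)
       (auto intro!: powr_mono2)
  then show ?thesis
    by (simp add: Lspace_def meas)
qed


section \<open>Independence of the underlying probability space\<close>

text \<open>
  The joint law of \<open>(V, \<zeta>)\<close> is determined by \<open>\<sigma>\<close>, and a model exists on a product space.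
  Hence an almost sure property of \<open>(V, \<zeta>)\<close> that holds in the product model holds in every model,
  over any sample space.
\<close>

definition model_law :: "'s measure \<Rightarrow> ((nat \<Rightarrow> 's) \<times> (nat \<Rightarrow> real)) measure"
  where "model_law \<sigma> =
    Pi\<^sub>M UNIV (\<lambda>_. uniform_measure \<sigma> (space \<sigma>)) \<Otimes>\<^sub>M
    Pi\<^sub>M UNIV (\<lambda>_. density lborel (\<lambda>x. ennreal (exponential_density 1 x)))"

lemma sets_model_law:
  "sets (model_law \<sigma>) = sets (Pi\<^sub>M UNIV (\<lambda>_. \<sigma>) \<Otimes>\<^sub>M Pi\<^sub>M UNIV (\<lambda>_. borel))"
  unfolding model_law_def by (intro sets_pair_measure_cong sets_PiM_cong) auto

lemma random_model_law:
  assumes "random_model \<sigma> Q V \<zeta>"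
  shows "(\<lambda>\<omega>. (\<lambda>j. V j \<omega>, \<lambda>j. \<zeta> j \<omega>)) \<in> measurable Q (model_law \<sigma>)" (is ?A)
    and "distr Q (model_law \<sigma>) (\<lambda>\<omega>. (\<lambda>j. V j \<omega>, \<lambda>j. \<zeta> j \<omega>)) = model_law \<sigma>" (is ?B)
proof -
  interpret prob_space Q
    using assms by (simp add: random_model_def)
  let ?S = "Pi\<^sub>M UNIV (\<lambda>_::nat. \<sigma>)" and ?T = "Pi\<^sub>M UNIV (\<lambda>_::nat. borel :: real measure)"
  let ?X = "\<lambda>\<omega> j. V j \<omega>" and ?Y = "\<lambda>\<omega> j. \<zeta> j \<omega>"
  have iV: "indep_vars (\<lambda>_. \<sigma>) V UNIV" and iz: "indep_vars (\<lambda>_. borel) \<zeta> UNIV"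
    and lV: "distr Q \<sigma> (V j) = uniform_measure \<sigma> (space \<sigma>)"
    and lz: "distributed Q lborel (\<zeta> j) (\<lambda>x. ennreal (exponential_density 1 x))"
    and ind: "indep_set (sets (vimage_algebra (space Q) ?X ?S)) (sets (vimage_algebra (space Q) ?Y ?T))"
    for j
    using assms by (auto simp: random_model_def)
  have rV: "random_variable \<sigma> (V j)" and rz: "random_variable borel (\<zeta> j)" for j
    using iV iz by (auto simp: indep_vars_def)
  have lz': "distr Q borel (\<zeta> j) = density lborel (\<lambda>x. ennreal (exponential_density 1 x))" for j
    using lz[of j] by (simp add: distributed_def cong: distr_cong)
  have "distr Q ?S ?X = Pi\<^sub>M UNIV (\<lambda>_. uniform_measure \<sigma> (space \<sigma>))"
    using iV indep_vars_iff_distr_eq_PiM[of UNIV V "\<lambda>_. \<sigma>"] rV lV by (simp add: restrict_UNIV)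
  moreover have "distr Q ?T ?Y
      = Pi\<^sub>M UNIV (\<lambda>_. density lborel (\<lambda>x. ennreal (exponential_density 1 x)))"
    using iz indep_vars_iff_distr_eq_PiM[of UNIV \<zeta> "\<lambda>_. borel"] rz lz' by (simp add: restrict_UNIV)
  moreover have XY: "random_variable ?S ?X" "random_variable ?T ?Y"
    using rV rz by (auto intro!: measurable_PiM_single' dest: measurable_space[OF rV])
  moreover have "distr Q ?S ?X \<Otimes>\<^sub>M distr Q ?T ?Y = distr Q (?S \<Otimes>\<^sub>M ?T) (\<lambda>\<omega>. (?X \<omega>, ?Y \<omega>))"
  proof (rule pair_measure_eqI)
    interpret X: prob_space "distr Q ?S ?X" by (rule prob_space_distr) fact
    interpret Y: prob_space "distr Q ?T ?Y" by (rule prob_space_distr) fact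
    show "sigma_finite_measure (distr Q ?S ?X)" "sigma_finite_measure (distr Q ?T ?Y)" ..
    fix A B assume A: "A \<in> sets (distr Q ?S ?X)" and B: "B \<in> sets (distr Q ?T ?Y)"
    have "prob ((?X -` A \<inter> space Q) \<inter> (?Y -` B \<inter> space Q))
        = prob (?X -` A \<inter> space Q) * prob (?Y -` B \<inter> space Q)"
      using A B by (intro indep_setD[OF ind] in_vimage_algebra) auto
    moreover have "(\<lambda>\<omega>. (?X \<omega>, ?Y \<omega>)) -` (A \<times> B) \<inter> space Q
        = (?X -` A \<inter> space Q) \<inter> (?Y -` B \<inter> space Q)"
      by auto
    ultimately show "emeasure (distr Q ?S ?X) A * emeasure (distr Q ?T ?Y) B
        = emeasure (distr Q (?S \<Otimes>\<^sub>M ?T) (\<lambda>\<omega>. (?X \<omega>, ?Y \<omega>))) (A \<times> B)"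
      using A B XY by (simp add: emeasure_distr measurable_Pair emeasure_eq_measure ennreal_mult)
  qed simp
  ultimately have "distr Q (?S \<Otimes>\<^sub>M ?T) (\<lambda>\<omega>. (?X \<omega>, ?Y \<omega>)) = model_law \<sigma>"
    by (simp add: model_law_def)
  moreover have "distr Q (model_law \<sigma>) (\<lambda>\<omega>. (?X \<omega>, ?Y \<omega>)) = distr Q (?S \<Otimes>\<^sub>M ?T) (\<lambda>\<omega>. (?X \<omega>, ?Y \<omega>))"
    by (rule distr_cong) (simp_all add: sets_model_law)
  ultimately show ?B by simp
  have "measurable Q (model_law \<sigma>) = measurable Q (?S \<Otimes>\<^sub>M ?T)"
    by (intro measurable_cong_sets refl sets_model_law)
  then show ?A
    using measurable_Pair[OF XY] by simp
qed

lemma random_model_AE: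
  assumes "random_model \<sigma> Q V \<zeta>" and "AE (v, x) in model_law \<sigma>. P v x"
  shows "AE \<omega> in Q. P (\<lambda>j. V j \<omega>) (\<lambda>j. \<zeta> j \<omega>)"
proof -
  have "AE y in distr Q (model_law \<sigma>) (\<lambda>\<omega>. (\<lambda>j. V j \<omega>, \<lambda>j. \<zeta> j \<omega>)). case y of (v, x) \<Rightarrow> P v x"
    using assms(2) by (subst random_model_law(2)[OF assms(1)])
  from AE_distrD[OF random_model_law(1)[OF assms(1)] this] show ?thesis by simp
qed

lemma random_model_exists:
  assumes "finite_measure \<sigma>" and "emeasure \<sigma> (space \<sigma>) \<noteq> 0"
  shows "random_model \<sigma> (model_law \<sigma>) (\<lambda>j y. fst y j) (\<lambda>j y. snd y j)"
proof -
  let ?U = "uniform_measure \<sigma> (space \<sigma>)"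
  let ?D = "density lborel (\<lambda>x. ennreal (exponential_density 1 x))"
  let ?S = "Pi\<^sub>M UNIV (\<lambda>_::nat. ?U)" and ?T = "Pi\<^sub>M UNIV (\<lambda>_::nat. ?D)"
  interpret finite_measure \<sigma> by fact
  interpret U: prob_space ?U
    using assms by (intro prob_space_uniform_measure) auto
  interpret D: prob_space ?D
    by (rule prob_space_exponential_density) simp
  interpret PU: product_prob_space "\<lambda>_::nat. ?U" UNIV ..
  interpret PD: product_prob_space "\<lambda>_::nat. ?D" UNIV ..
  interpret P: pair_prob_space ?S ?T ..
  have law: "model_law \<sigma> = ?S \<Otimes>\<^sub>M ?T"
    by (simp add: model_law_def)
  have sS: "sets (Pi\<^sub>M UNIV (\<lambda>_::nat. \<sigma>)) = sets ?S"
    and sT: "sets (Pi\<^sub>M UNIV (\<lambda>_::nat. borel :: real measure)) = sets ?T"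
    by (intro sets_PiM_cong; simp)+
  have dS: "distr (?S \<Otimes>\<^sub>M ?T) (Pi\<^sub>M UNIV (\<lambda>_. \<sigma>)) fst = ?S"
  proof -
    have "distr (?S \<Otimes>\<^sub>M ?T) (Pi\<^sub>M UNIV (\<lambda>_. \<sigma>)) fst = distr (?S \<Otimes>\<^sub>M ?T) ?S fst"
      by (rule distr_cong) (auto simp: sS)
    then show ?thesis by (simp add: PD.distr_pair_fst)
  qed
  have dT: "distr (?S \<Otimes>\<^sub>M ?T) (Pi\<^sub>M UNIV (\<lambda>_. borel)) snd = ?T"
  proof -
    have "distr (?S \<Otimes>\<^sub>M ?T) (Pi\<^sub>M UNIV (\<lambda>_. borel)) snd = distr (?S \<Otimes>\<^sub>M ?T) ?T snd"
      by (rule distr_cong) (auto simp: sT)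
    also have "\<dots> = ?T"
    proof -
      have "distr (?S \<Otimes>\<^sub>M ?T) ?T snd = distr (?T \<Otimes>\<^sub>M ?S) ?T (snd \<circ> (\<lambda>(x, y). (y, x)))"
        by (subst P.distr_pair_swap, subst distr_distr) auto
      also have "\<dots> = distr (?T \<Otimes>\<^sub>M ?S) ?T fst"
        by (rule distr_cong) auto
      finally show ?thesis by (simp add: PU.distr_pair_fst)
    qed
    finally show ?thesis .
  qed
  have mV: "(\<lambda>y. fst y j) \<in> measurable (?S \<Otimes>\<^sub>M ?T) \<sigma>" for j
  proof -
    have "(\<lambda>y. fst y j) \<in> measurable (?S \<Otimes>\<^sub>M ?T) ?U" by measurable
    then show ?thesis by (simp cong: measurable_cong_sets)
  qed
  have mz: "(\<lambda>y. snd y j) \<in> measurable (?S \<Otimes>\<^sub>M ?T) borel" for j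
  proof -
    have "(\<lambda>y. snd y j) \<in> measurable (?S \<Otimes>\<^sub>M ?T) ?D" by measurable
    then show ?thesis by (simp cong: measurable_cong_sets)
  qed
  have lV: "distr (?S \<Otimes>\<^sub>M ?T) \<sigma> (\<lambda>y. fst y j) = ?U" for j
  proof -
    have "distr (?S \<Otimes>\<^sub>M ?T) \<sigma> (\<lambda>y. fst y j) = distr (?S \<Otimes>\<^sub>M ?T) ?U ((\<lambda>f. f j) \<circ> fst)"
      by (rule distr_cong) auto
    also have "\<dots> = distr (distr (?S \<Otimes>\<^sub>M ?T) ?S fst) ?U (\<lambda>f. f j)"
      by (subst distr_distr) auto
    also have "\<dots> = ?U"
      by (simp add: PD.distr_pair_fst PU.PiM_component)
    finally show ?thesis .
  qed
  have dT': "distr (?S \<Otimes>\<^sub>M ?T) ?T snd = ?T"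
    using dT by (subst (asm) distr_cong[OF refl sT refl]) auto
  have lz: "distr (?S \<Otimes>\<^sub>M ?T) N (\<lambda>y. snd y j) = ?D" if "sets N = sets borel" for j N
  proof -
    have "distr (?S \<Otimes>\<^sub>M ?T) N (\<lambda>y. snd y j) = distr (?S \<Otimes>\<^sub>M ?T) ?D ((\<lambda>f. f j) \<circ> snd)"
      by (rule distr_cong) (auto simp: that)
    also have "\<dots> = distr (distr (?S \<Otimes>\<^sub>M ?T) ?T snd) ?D (\<lambda>f. f j)"
      by (subst distr_distr) auto
    also have "\<dots> = ?D"
      unfolding dT' by (simp add: PD.PiM_component)
    finally show ?thesis .
  qed
  have iV: "P.indep_vars (\<lambda>_. \<sigma>) (\<lambda>j y. fst y j) UNIV"
    using dS by (subst P.indep_vars_iff_distr_eq_PiM) (auto simp: mV lV restrict_UNIV)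
  have iz: "P.indep_vars (\<lambda>_. borel) (\<lambda>j y. snd y j) UNIV"
    using dT by (subst P.indep_vars_iff_distr_eq_PiM) (auto simp: mz lz restrict_UNIV)
  have mf: "fst \<in> measurable (?S \<Otimes>\<^sub>M ?T) (Pi\<^sub>M UNIV (\<lambda>_. \<sigma>))"
    using measurable_fst[of ?S ?T] measurable_cong_sets[OF refl sS] by blast
  have ms: "snd \<in> measurable (?S \<Otimes>\<^sub>M ?T) (Pi\<^sub>M UNIV (\<lambda>_. borel))"
    using measurable_snd[of ?S ?T] measurable_cong_sets[OF refl sT] by blast
  have ind: "P.indep_set
      (sets (vimage_algebra (space (?S \<Otimes>\<^sub>M ?T)) (\<lambda>y j. fst y j) (Pi\<^sub>M UNIV (\<lambda>_. \<sigma>))))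
      (sets (vimage_algebra (space (?S \<Otimes>\<^sub>M ?T)) (\<lambda>y j. snd y j) (Pi\<^sub>M UNIV (\<lambda>_. borel))))"
    (is "P.indep_set ?F ?G")
  proof (rule P.indep_setI)
    have F: "?F = {fst -` A \<inter> space (?S \<Otimes>\<^sub>M ?T) |A. A \<in> sets ?S}"
      using measurable_space[OF mf] by (subst sets_vimage_algebra2) (auto simp: sS)
    have G: "?G = {snd -` A \<inter> space (?S \<Otimes>\<^sub>M ?T) |A. A \<in> sets ?T}"
      using measurable_space[OF ms] by (subst sets_vimage_algebra2) (auto simp: sT)
    show "?F \<subseteq> sets (?S \<Otimes>\<^sub>M ?T)" "?G \<subseteq> sets (?S \<Otimes>\<^sub>M ?T)"
      unfolding F G by (auto intro: measurable_sets)
    fix a b assume "a \<in> ?F" "b \<in> ?G"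
    then obtain A B where A: "A \<in> sets ?S" and B: "B \<in> sets ?T"
      and ab: "a = fst -` A \<inter> space (?S \<Otimes>\<^sub>M ?T)" "b = snd -` B \<inter> space (?S \<Otimes>\<^sub>M ?T)"
      unfolding F G by blast
    have "A \<subseteq> space ?S" "B \<subseteq> space ?T"
      using A B by (auto dest: sets.sets_into_space)
    then have eq: "a = A \<times> space ?T" "b = space ?S \<times> B" "a \<inter> b = A \<times> B"
      unfolding ab space_pair_measure by auto
    show "P.prob (a \<inter> b) = P.prob a * P.prob b"
      unfolding eq(3) unfolding eq(1,2) measure_def using A B
      by (simp add: PD.P.emeasure_pair_measure_Times enn2real_mult
          PU.P.emeasure_space_1 PD.P.emeasure_space_1)
  qed
  show ?thesis
    unfolding random_model_def law
    using P.prob_space_axioms iV iz ind lV mz lz[of lborel] by (simp add: distributed_def)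
qed

end

theory Submission
  imports Defs
begin

text \<open>
  The measure is prescribed through its hazard rate. Put \<open>b k = d k powr (- \<alpha>) / k\<close> and let
  \<open>\<sigma>\<close> give the \<open>k\<close>-th point the mass \<open>f k = b k * T k\<close>, where \<open>T k\<close> is the product of the
  factors \<open>1 / (1 + b j)\<close> over \<open>1 \<le> j \<le> k\<close>. Then \<open>f k = T (k - 1) - T k\<close>, so \<open>T k\<close> is the mass
  beyond the first \<open>k\<close> points, and the total mass is 1 because the divergence of the series of
  the \<open>b k\<close> makes \<open>T\<close> tend to 0. The sequence \<open>k * f k = d k powr (- \<alpha>) * T k\<close> decreases,
  and \<open>f\<close> loses at most a constant factor from \<open>k\<close> to \<open>2 * k\<close>.

  The upper bound for \<open>u\<close>. As a diagonal operator into \<open>\<ell>\<^sub>\<alpha>\<close>, the embedding has the weights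
  \<open>f k powr (1 / \<alpha>)\<close>, and its \<open>n\<close>-th entropy number is at most a multiple of
  \<open>f n powr (1 / \<alpha>) * n powr (1 / \<alpha> - 1 / p)\<close>, as if all weights beyond the first \<open>n\<close> vanished
  and the first \<open>n\<close> were equal (\<open>entropy_number_embedding_le\<close>). The covering comes from rounding
  the \<open>k\<close>-th coordinate to a grid whose mesh grows with \<open>k\<close>. The grid points that occur are
  counted by an exponential moment, and the two properties of \<open>f\<close> control the rounding error.

  The lower bound for \<open>v\<close>. A set of fewer than \<open>4 * n\<close> points misses at least the mass
  \<open>T (4 * n)\<close>. Therefore, as long as fewer than \<open>4 * n\<close> values have occurred, the next \<open>V\<^sub>j\<close> is
  a new one with at least this probability. With overwhelming probability the first \<open>M\<close> draws,
  where \<open>M\<close> is about \<open>16 * n / T (4 * n)\<close>, thus show \<open>4 * n\<close> different values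
  (\<open>AE_many_values\<close>). Also \<open>\<Gamma>\<^sub>M \<le> 4 * M\<close>, so \<open>v\<close> dominates a multiple of
  \<open>M powr (- 1 / \<alpha>)\<close> times the identity on \<open>4 * n\<close> coordinates. For that operator, vertices of a
  cube with large Hamming distances give the bound
  \<open>M powr (- 1 / \<alpha>) * n powr (1 / 2 - 1 / p)\<close> (\<open>entropy_number_ge_of_large_coordinates\<close>).

  As \<open>T n\<close> and \<open>T (4 * n)\<close> are comparable, the gap is at least a multiple of
  \<open>(T n / (n * f n)) powr (1 / \<alpha>)\<close>, and this is exactly \<open>d n\<close>. Since \<open>v\<close> carries the factor
  \<open>c_stable \<alpha>\<close>, the argument needs \<open>c_stable \<alpha> > 0\<close>, which includes the convergence of the sine
  integral.
\<close>


section \<open>Positivity of the stable constant\<close>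

lemma one_minus_cos_le_square:
  fixes x :: real
  shows "1 - cos x \<le> x\<^sup>2 / 2"
proof -
  have "\<bar>sin (x / 2)\<bar> \<le> \<bar>x / 2\<bar>"
    by (rule abs_sin_x_le_abs_x)
  then have "(sin (x / 2))\<^sup>2 \<le> (x / 2)\<^sup>2"
    by (rule abs_le_square_iff[THEN iffD1])
  moreover have "1 - cos x = 2 * (sin (x / 2))\<^sup>2"
    using cos_double_sin[of "x / 2"] by simp
  ultimately show ?thesis
    by (simp add: power2_eq_square)
qed

lemma powr_one_minus_cos_le:
  fixes a x :: real
  assumes "0 < x"
  shows "x powr (- a) * (1 - cos x) \<le> x powr (2 - a) / 2"
proof -
  have "x powr (- a) * (1 - cos x) \<le> x powr (- a) * (x\<^sup>2 / 2)"
    by (intro mult_left_mono one_minus_cos_le_square) simp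
  also have "\<dots> = x powr (2 - a) / 2"
    using assms by (simp add: powr_diff powr_minus powr_numeral field_simps)
  finally show ?thesis .
qed

text \<open>
  The integrand is of order \<open>x powr (1 - a)\<close> at 0, integrable as \<open>a < 2\<close>, and of order
  \<open>x powr (- a - 1)\<close> at infinity, integrable as \<open>a > 0\<close>.
\<close>
lemma integrable_powr_one_minus_cos:
  fixes a :: real
  assumes "0 < a" "a < 2"
  shows "(\<lambda>x. x powr (- a - 1) * (1 - cos x)) integrable_on {0..}"
proof -
  let ?g = "\<lambda>x::real. x powr (- a - 1) * (1 - cos x)"
  have meas: "?g \<in> borel_measurable (lebesgue_on S)" for S
  proof -
    have "?g \<in> borel_measurable lborel" by measurable
    then have "?g \<in> borel_measurable lebesgue"
      by (rule measurable_completion)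
    then show ?thesis
      by (rule measurable_restrict_space1)
  qed
  have "?g integrable_on {0..1}"
  proof (rule measurable_bounded_by_integrable_imp_integrable[OF meas])
    show "(\<lambda>x. x powr (1 - a) / 2) integrable_on {0..1}"
      using integrable_on_powr_from_0[of "1 - a" 1] assms
        integrable_on_cmult_left[of "\<lambda>x. x powr (1 - a)" "{0..1}" "1 / 2"] by simp
    show "norm (?g x) \<le> x powr (1 - a) / 2" if "x \<in> {0..1}" for x
      using powr_one_minus_cos_le[of x "a + 1"] that
      by (cases "x = 0") (auto simp: abs_mult)
  qed simp
  moreover have "?g integrable_on {1..}"
  proof (rule measurable_bounded_by_integrable_imp_integrable[OF meas])
    show "(\<lambda>x. 2 * x powr (- a - 1)) integrable_on {1..}"
      using has_integral_powr_to_inf[of "- a - 1" 1] assms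
      by (simp add: integrable_on_cmult_left has_integral_integrable)
    show "norm (?g x) \<le> 2 * x powr (- a - 1)" if "x \<in> {1..}" for x
    proof -
      have "\<bar>1 - cos x\<bar> \<le> 2"
        using cos_ge_minus_one[of x] cos_le_one[of x] by linarith
      then show ?thesis
        using mult_left_mono[of "\<bar>1 - cos x\<bar>" 2 "x powr (- a - 1)"] by (simp add: abs_mult)
    qed
  qed simp
  ultimately have "?g integrable_on ({0..1} \<union> {1..})"
    by (rule integrable_Un') (auto simp: max_def intro: negligible_subset[of "{1}"])
  also have "{0..1} \<union> {1..} = {0::real..}"
    by auto
  finally show ?thesis .
qed

text \<open>
  For \<open>a \<le> 1\<close> the sine integral is only conditionally convergent. Integration by parts with the
  primitive \<open>1 - cos x\<close> of \<open>sin x\<close> turns it into an absolutely convergent integral with a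
  nonnegative integrand, which yields existence and, below, positivity. The boundary term
  \<open>x powr (- a) * (1 - cos x)\<close> vanishes at 0 and at infinity.
\<close>
lemma sine_integral_by_parts:
  fixes a :: real
  assumes a: "0 < a" "a < 2"
  shows "((\<lambda>x. x powr (- a) * sin x) has_integral
      a * integral {0..} (\<lambda>x. x powr (- a - 1) * (1 - cos x))) {0..}"
proof -
  let ?G = "\<lambda>x::real. x powr (- a) * (1 - cos x)"
  let ?g = "\<lambda>x::real. a * (x powr (- a - 1) * (1 - cos x))"
  let ?h = "\<lambda>x::real. x powr (- a) * sin x - ?g x"
  have cont0: "(?G \<longlongrightarrow> 0) (at 0 within {0..b})" for b
  proof (rule tendsto_sandwich)
    show "\<forall>\<^sub>F x in at 0 within {0..b}. 0 \<le> ?G x"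
      by (intro always_eventually) (auto intro!: mult_nonneg_nonneg)
    show "\<forall>\<^sub>F x in at 0 within {0..b}. ?G x \<le> x powr (2 - a) / 2"
      using powr_one_minus_cos_le[of _ a] by (auto simp: eventually_at_filter)
    have "((\<lambda>x::real. x powr (2 - a)) \<longlongrightarrow> 0 powr (2 - a)) (at 0 within {0..b})"
      using a by (intro tendsto_powr2 tendsto_intros) (auto simp: eventually_at_filter)
    then show "((\<lambda>x::real. x powr (2 - a) / 2) \<longlongrightarrow> 0) (at 0 within {0..b})"
      using a tendsto_divide[OF _ tendsto_const, of _ 0 _ 2] by simp
    show "((\<lambda>x::real. 0::real) \<longlongrightarrow> 0) (at 0 within {0..b})"
      by (rule tendsto_const)
  qed
  have cont: "continuous_on {0..b} ?G" for b
    unfolding continuous_on_def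
  proof
    fix x assume "x \<in> {0..b}"
    show "(?G \<longlongrightarrow> ?G x) (at x within {0..b})"
    proof (cases "x = 0")
      case True
      then show ?thesis using cont0 by simp
    next
      case False
      then show ?thesis
        by (intro tendsto_intros) auto
    qed
  qed
  have part: "(?h has_integral ?G b) {0..b}" if "0 \<le> b" for b
  proof -
    have "(?G has_vector_derivative ?h x) (at x)" if "x \<in> {0<..<b}" for x
      unfolding has_real_derivative_iff_has_vector_derivative[symmetric]
      using that by (auto intro!: derivative_eq_intros simp: powr_diff field_simps)
    from fundamental_theorem_of_calculus_interior[OF that cont this] show ?thesis
      by simp
  qed
  have "(?h has_integral 0) {0..}"
  proof (subst has_integral', intro allI impI)
    fix e :: real assume e: "0 < e"
    have "((\<lambda>b::real. 2 * b powr (- a)) \<longlongrightarrow> 0) at_top"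
      by (rule tendsto_mult_right_zero, rule tendsto_neg_powr) (use a in \<open>auto intro: filterlim_ident\<close>)
    then have "\<forall>\<^sub>F b in at_top. 2 * b powr (- a) < e"
      using e by (simp add: order_tendsto_iff)
    then obtain B where B: "\<And>b::real. B \<le> b \<Longrightarrow> 2 * b powr (- a) < e"
      by (auto simp: eventually_at_top_linorder)
    show "\<exists>B>0. \<forall>c b. ball 0 B \<subseteq> cbox c b \<longrightarrow>
        (\<exists>z. ((\<lambda>x. if x \<in> {0..} then ?h x else 0) has_integral z) (cbox c b) \<and> norm (z - 0) < e)"
    proof (rule exI[of _ "max 1 B"], intro conjI allI impI)
      fix c b :: real assume "ball 0 (max 1 B) \<subseteq> cbox c b"
      then have "{- max 1 B<..<max 1 B} \<subseteq> {c..b}"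
        by (simp add: ball_eq_greaterThanLessThan)
      then have cb: "c \<le> - max 1 B" "max 1 B \<le> b"
        by (auto simp: greaterThanLessThan_subseteq_atLeastAtMost_iff)
      then have "{0..} \<inter> cbox c b = {0..b}" and b: "0 \<le> b" "B \<le> b"
        by auto
      then have "((\<lambda>x. if x \<in> {0..} then ?h x else 0) has_integral ?G b) (cbox c b)"
        using part[of b] by (subst has_integral_restrict_Int) simp
      moreover have "\<bar>1 - cos b\<bar> \<le> 2"
        using cos_ge_minus_one[of b] cos_le_one[of b] by linarith
      then have "norm (?G b - 0) < e"
        using mult_left_mono[of "\<bar>1 - cos b\<bar>" 2 "b powr (- a)"] B[OF b(2)]
        by (simp add: abs_mult)
      ultimately show "\<exists>z. ((\<lambda>x. if x \<in> {0..} then ?h x else 0) has_integral z) (cbox c b)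
          \<and> norm (z - 0) < e"
        by blast
    qed simp
  qed
  moreover have "(?g has_integral a * integral {0..} (\<lambda>x. x powr (- a - 1) * (1 - cos x))) {0..}"
    using integrable_powr_one_minus_cos[OF a]
    by (intro has_integral_mult_right integrable_integral)
  ultimately have "((\<lambda>x. ?h x + ?g x) has_integral
      0 + a * integral {0..} (\<lambda>x. x powr (- a - 1) * (1 - cos x))) {0..}"
    by (rule has_integral_add)
  then show ?thesis by simp
qed

lemma sine_integral_pos:
  fixes a :: real
  assumes a: "0 < a" "a < 2"
  shows "0 < integral {0..} (\<lambda>x. x powr (- a) * sin x)"
proof -
  let ?g = "\<lambda>x::real. x powr (- a - 1) * (1 - cos x)"
  have int: "?g integrable_on {0..}"
    by (rule integrable_powr_one_minus_cos[OF a])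
  have int': "?g integrable_on {pi/2..pi}"
    by (rule integrable_on_subinterval[OF int]) auto
  have "0 < (pi - pi/2) * pi powr (- a - 1)"
    by simp
  also have "\<dots> = integral {pi/2..pi} (\<lambda>x. pi powr (- a - 1))"
    by simp
  also have "\<dots> \<le> integral {pi/2..pi} ?g"
  proof (rule integral_le[OF _ int'])
    fix x :: real assume x: "x \<in> {pi/2..pi}"
    then have "cos x \<le> cos (pi / 2)"
      by (intro cos_monotone_0_pi_le) auto
    then have "1 \<le> 1 - cos x"
      by simp
    moreover have "pi powr (- a - 1) \<le> x powr (- a - 1)"
      using x a pi_gt_zero by (intro powr_mono2') (auto simp del: pi_gt_zero)
    ultimately show "pi powr (- a - 1) \<le> ?g x"
      using mult_mono[of "pi powr (- a - 1)" "x powr (- a - 1)" 1 "1 - cos x"] by simp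
  qed (rule integrable_const_ivl)
  also have "\<dots> \<le> integral {0..} ?g"
    by (rule integral_subset_le[OF _ int' int]) (auto intro!: mult_nonneg_nonneg)
  finally show ?thesis
    using integral_unique[OF sine_integral_by_parts[OF a]] a by simp
qed

text \<open>
  The value 0 could also come from a divergent integral, so integrability is part of the proof;
  it follows from comparison with the second moment.
\<close>
lemma normal_abs_moment_pos:
  fixes a :: real
  assumes "0 \<le> a" "a \<le> 2"
  shows "0 < (LINT x|density lborel std_normal_density. \<bar>x\<bar> powr a)"
proof -
  let ?N = "density lborel (\<lambda>x. ennreal (std_normal_density x))"
  interpret prob_space ?N
    by (rule prob_space_normal_density) simp
  have "integrable lborel (\<lambda>x. std_normal_density x *\<^sub>R x\<^sup>2)"
    using integrable_std_normal_moment[of 2] by simp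
  then have sq: "integrable ?N (\<lambda>x. x\<^sup>2)"
    by (subst integrable_density) auto
  have int: "integrable ?N (\<lambda>x. \<bar>x\<bar> powr a)"
  proof (rule Bochner_Integration.integrable_bound)
    show "integrable ?N (\<lambda>x. 1 + x\<^sup>2)"
      using sq by simp
    have "\<bar>x\<bar> powr a \<le> 1 + x\<^sup>2" for x :: real
    proof (cases "\<bar>x\<bar> \<le> 1")
      case True
      then have "\<bar>x\<bar> powr a \<le> 1"
        using powr_le1[of a "\<bar>x\<bar>"] assms by simp
      then show ?thesis by (simp add: add_increasing2)
    next
      case False
      then have "\<bar>x\<bar> powr a \<le> \<bar>x\<bar> powr 2"
        using assms by (intro powr_mono) auto
      then show ?thesis by simp
    qed
    then show "AE x in ?N. norm (\<bar>x\<bar> powr a) \<le> norm (1 + x\<^sup>2)"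
      by (intro AE_I2) (simp add: abs_of_nonneg)
  qed simp
  have "\<not> (AE x in ?N. \<bar>x\<bar> powr a = 0)"
  proof
    assume "AE x in ?N. \<bar>x\<bar> powr a = 0"
    then have "AE x in lborel. x = (0::real)"
      using normal_density_pos[of 1 0] by (subst (asm) AE_density) (auto simp: less_imp_neq)
    moreover have "AE x in lborel. x \<noteq> (0::real)"
      by (rule AE_lborel_singleton)
    ultimately have "AE x in (lborel :: real measure). False"
      by eventually_elim simp
    then show False
      by (simp add: AE_iff_measurable[OF _ refl, where M = "lborel :: real measure", of "\<lambda>_. False"]) 
  qed
  then have "(LINT x|?N. \<bar>x\<bar> powr a) \<noteq> 0"
    using integral_nonneg_eq_0_iff_AE[OF int] by simp
  moreover have "0 \<le> (LINT x|?N. \<bar>x\<bar> powr a)"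
    by (rule integral_nonneg_AE) simp
  ultimately show ?thesis by linarith
qed

lemma c_stable_pos:
  assumes "0 < \<alpha>" "\<alpha> < 2"
  shows "0 < c_stable \<alpha>"
  unfolding c_stable_def
  using sine_integral_pos[OF assms] normal_abs_moment_pos[of \<alpha>] assms
  by (intro mult_pos_pos) auto


section \<open>Weights with a doubling property\<close>

text \<open>
  The masses of the measure, numbered from 1. The first condition on their size says that they
  decay at least like \<open>1 / k\<close>, the second that they decay at most polynomially.
\<close>
locale regular_weight =
  fixes f :: "nat \<Rightarrow> real" and R :: real
  assumes pos: "1 \<le> k \<Longrightarrow> 0 < f k"
    and decreasing: "1 \<le> j \<Longrightarrow> j \<le> k \<Longrightarrow> real k * f k \<le> real j * f j"
    and doubling: "1 \<le> k \<Longrightarrow> f k \<le> R * f (2 * k)"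
begin

lemma two_le_R: "2 \<le> R"
proof -
  have "2 * f 2 \<le> R * f 2"
    using decreasing[of 1 2] doubling[of 1] by simp
  then show ?thesis
    using pos[of 2] by simp
qed

lemma antitone:
  assumes "1 \<le> j" "j \<le> k"
  shows "f k \<le> f j"
proof -
  have "real j * f k \<le> real k * f k"
    using assms pos[of k] by (intro mult_right_mono) auto
  also have "\<dots> \<le> real j * f j"
    by (rule decreasing[OF assms])
  finally show ?thesis
    using assms by simp
qed

lemma le_power_doubling:
  assumes "1 \<le> k"
  shows "f k \<le> R ^ l * f (2 ^ l * k)"
proof (induction l)
  case (Suc l)
  have "f (2 ^ l * k) \<le> R * f (2 ^ Suc l * k)"
    using doubling[of "2 ^ l * k"] assms by (simp add: mult.assoc)
  then have "R ^ l * f (2 ^ l * k) \<le> R ^ l * (R * f (2 ^ Suc l * k))"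
    using two_le_R by (intro mult_left_mono) auto
  with Suc show ?case by (simp add: ac_simps)
qed simp

text \<open>The exponent of the polynomial lower bound on the decay in \<open>le_powr_ratio\<close>.\<close>
definition growth_exponent :: real where "growth_exponent = log 2 R"

lemma growth_exponent_ge_1: "1 \<le> growth_exponent"
  using two_le_R by (simp add: growth_exponent_def le_log_iff)

lemma le_powr_ratio:
  assumes "1 \<le> k" "k \<le> n"
  shows "f k \<le> R * (real n / real k) powr growth_exponent * f n"
proof -
  define x where "x = log 2 (real n / real k)"
  define l where "l = nat \<lceil>x\<rceil>"
  have x0: "0 \<le> x"
    using assms by (simp add: x_def)
  then have l: "x \<le> real l" "real l \<le> 1 + x"
    unfolding l_def by linarith+
  obtain c where c: "growth_exponent = c" "0 \<le> c"
    using growth_exponent_ge_1 by simp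
  have R: "R = 2 powr c"
    using two_le_R unfolding c(1)[symmetric] by (simp add: growth_exponent_def)
  have "real n / real k = 2 powr x"
    using assms by (simp add: x_def)
  also have "\<dots> \<le> 2 ^ l"
    using l powr_mono[of x "real l" 2] by (simp add: powr_realpow)
  finally have "real n \<le> real (2 ^ l * k)"
    using assms by (simp add: field_simps)
  then have "n \<le> 2 ^ l * k"
    by linarith
  then have "f (2 ^ l * k) \<le> f n"
    using assms by (intro antitone) auto
  moreover have "R ^ l \<le> R * (real n / real k) powr c"
  proof -
    have "R ^ l = 2 powr (c * real l)"
      by (simp add: R powr_powr[symmetric] powr_realpow)
    also have "\<dots> \<le> 2 powr (c * (1 + x))"
      using l c by (intro powr_mono mult_left_mono) auto
    also have "\<dots> = R * (2 powr x) powr c"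
      by (simp add: R powr_powr powr_add[symmetric] algebra_simps)
    also have "2 powr x = real n / real k"
      using assms by (simp add: x_def)
    finally show ?thesis .
  qed
  ultimately have "R ^ l * f (2 ^ l * k) \<le> (R * (real n / real k) powr growth_exponent) * f n"
    unfolding c(1) using two_le_R pos[of "2 ^ l * k"] assms by (intro mult_mono) auto
  with le_power_doubling[OF assms(1), of l] show ?thesis by linarith
qed

end


section \<open>Counting lattice points\<close>

lemma sum_inverse_powr_tail_le:
  fixes \<rho> :: real
  assumes "1 < \<rho>" "1 \<le> m"
  shows "(\<Sum>i\<in>{m..<n}. (real m / real (Suc i)) powr \<rho>) \<le> real m / (\<rho> - 1)"
proof -
  have step: "(\<rho> - 1) * real (Suc i) powr (- \<rho>) \<le> real i powr (1 - \<rho>) - real (Suc i) powr (1 - \<rho>)"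
    if "m \<le> i" for i
  proof -
    have "real i < real (Suc i)" by simp
    moreover have "((\<lambda>x. x powr (1 - \<rho>)) has_real_derivative (1 - \<rho>) * x powr (- \<rho>)) (at x)"
      if "real i \<le> x" "x \<le> real (Suc i)" for x
      using \<open>m \<le> i\<close> assms that by (auto intro!: derivative_eq_intros)
    ultimately obtain \<xi> where \<xi>: "real i < \<xi>" "\<xi> < real (Suc i)"
      "real (Suc i) powr (1 - \<rho>) - real i powr (1 - \<rho>) = (real (Suc i) - real i) * ((1 - \<rho>) * \<xi> powr (- \<rho>))"
      using MVT2[of "real i" "real (Suc i)" "\<lambda>x. x powr (1 - \<rho>)" "\<lambda>x. (1 - \<rho>) * x powr (- \<rho>)"] by blast
    have "real (Suc i) powr (- \<rho>) \<le> \<xi> powr (- \<rho>)"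
      using \<xi> assms by (intro powr_mono2') auto
    then have "(\<rho> - 1) * real (Suc i) powr (- \<rho>) \<le> (\<rho> - 1) * \<xi> powr (- \<rho>)"
      using assms by (intro mult_left_mono) auto
    then show ?thesis
      using \<xi>(3) by (simp add: algebra_simps)
  qed
  have "(\<Sum>i\<in>{m..<n}. (real m / real (Suc i)) powr \<rho>)
      = real m powr \<rho> * (\<Sum>i\<in>{m..<n}. real (Suc i) powr (- \<rho>))"
    by (simp add: sum_distrib_left powr_divide powr_minus field_simps)
  also have "\<dots> \<le> real m powr \<rho> * (real m powr (1 - \<rho>) / (\<rho> - 1))"
  proof (intro mult_left_mono)
    show "(\<Sum>i\<in>{m..<n}. real (Suc i) powr (- \<rho>)) \<le> real m powr (1 - \<rho>) / (\<rho> - 1)"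
    proof (cases "m \<le> n")
      case True
      have "(\<rho> - 1) * (\<Sum>i\<in>{m..<n}. real (Suc i) powr (- \<rho>))
          \<le> (\<Sum>i\<in>{m..<n}. real i powr (1 - \<rho>) - real (Suc i) powr (1 - \<rho>))"
        unfolding sum_distrib_left by (intro sum_mono step) auto
      also have "\<dots> = real m powr (1 - \<rho>) - real n powr (1 - \<rho>)"
        using sum_Suc_diff'[OF True, of "\<lambda>i. - (real i powr (1 - \<rho>))"] by simp
      also have "\<dots> \<le> real m powr (1 - \<rho>)"
        by simp
      finally show ?thesis
        using assms by (simp add: pos_le_divide_eq mult.commute)
    qed (use assms in auto)
  qed simp
  also have "\<dots> = real m / (\<rho> - 1)"
    using assms by (simp add: powr_add[symmetric])
  finally show ?thesis .
qed

text \<open>Half of the sum without its central term is dominated by a geometric series.\<close>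
lemma sum_exp_neg_abs_int_le:
  fixes t :: real
  assumes "0 < t"
  shows "(\<Sum>a\<in>{- int L..int L}. exp (- (t * \<bar>real_of_int a\<bar>))) \<le> 1 + 2 / (exp t - 1)"
proof -
  define x where "x = exp (- t)"
  have x: "0 < x" "x < 1"
    using assms by (auto simp: x_def)
  have "(\<Sum>a\<in>{- int L..int L}. exp (- (t * \<bar>real_of_int a\<bar>))) = 1 + 2 * (\<Sum>i<L. x ^ Suc i)"
  proof (induction L)
    case (Suc L)
    have "{- int (Suc L)..int (Suc L)} = insert (- int (Suc L)) (insert (int (Suc L)) {- int L..int L})"
      by auto
    moreover have "exp (- (t * (real L + 1))) = x ^ Suc L"
      unfolding x_def exp_of_nat_mult[symmetric] by (simp add: algebra_simps)
    ultimately show ?case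
      using Suc by (simp add: add.commute)
  qed simp
  also have "(\<Sum>i<L. x ^ Suc i) \<le> x / (1 - x)"
  proof -
    have "(\<Sum>i<L. x ^ Suc i) = x * ((1 - x ^ L) / (1 - x))"
      using x by (simp add: sum_distrib_left[symmetric] sum_gp_strict)
    also have "\<dots> \<le> x * (1 / (1 - x))"
      using x by (intro mult_left_mono divide_right_mono) auto
    finally show ?thesis by simp
  qed
  also have "x / (1 - x) = 1 / (exp t - 1)"
    using assms by (simp add: x_def exp_minus field_simps)
  finally show ?thesis by simp
qed

text \<open>
  Chernoff's method for counting: every lattice point of the set contributes at least 1 to the
  sum of \<open>exp (s - \<dots>)\<close> over a large box, and over the box the sum factorises. Replacing the
  exponent \<open>p\<close> by 1 is harmless because nonzero integers have absolute value at least 1.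
\<close>
lemma card_lattice_points_le:
  fixes t :: "'i \<Rightarrow> real" and p s :: real
  assumes I: "finite I" and t: "\<And>i. i \<in> I \<Longrightarrow> 0 < t i" and p: "1 \<le> p" and s: "0 \<le> s"
  defines "A \<equiv> {a \<in> I \<rightarrow>\<^sub>E (UNIV :: int set). (\<Sum>i\<in>I. t i * \<bar>real_of_int (a i)\<bar> powr p) \<le> s}"
  shows "finite A" and "real (card A) \<le> exp s * (\<Prod>i\<in>I. 1 + 2 / (exp (t i) - 1))"
proof -
  have abs_le: "\<bar>real_of_int c\<bar> \<le> \<bar>real_of_int c\<bar> powr p" for c
    using powr_mono[of 1 p "\<bar>real_of_int c\<bar>"] p by (cases "c = 0") auto
  define L where "L = nat \<lceil>\<Sum>i\<in>I. s / t i\<rceil>"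
  define B where "B = (\<Pi>\<^sub>E i\<in>I. {- int L..int L})"
  have finB: "finite B"
    unfolding B_def using I by (intro finite_PiE) auto
  have sub: "A \<subseteq> B"
  proof
    fix a assume a: "a \<in> A"
    have "a i \<in> {- int L..int L}" if i: "i \<in> I" for i
    proof -
      have "t i * \<bar>real_of_int (a i)\<bar> \<le> t i * \<bar>real_of_int (a i)\<bar> powr p"
        using t[OF i] abs_le by (intro mult_left_mono) auto
      also have "\<dots> \<le> (\<Sum>i\<in>I. t i * \<bar>real_of_int (a i)\<bar> powr p)"
        using I i t by (intro member_le_sum) (auto intro!: mult_nonneg_nonneg intro: less_imp_le)
      also have "\<dots> \<le> s"
        using a by (simp add: A_def)
      finally have "\<bar>real_of_int (a i)\<bar> \<le> s / t i"
        using t[OF i] by (simp add: field_simps)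
      also have "\<dots> \<le> (\<Sum>i\<in>I. s / t i)"
        using I i t s by (intro member_le_sum) (auto intro!: divide_nonneg_nonneg intro: less_imp_le)
      finally have "\<bar>a i\<bar> \<le> int L"
        unfolding L_def by linarith
      then show ?thesis by auto
    qed
    then show "a \<in> B"
      using a by (auto simp: A_def B_def PiE_iff)
  qed
  then show "finite A"
    using finB by (rule finite_subset)
  have "real (card A) = (\<Sum>a\<in>A. 1)"
    by simp
  also have "\<dots> \<le> (\<Sum>a\<in>A. exp (s - (\<Sum>i\<in>I. t i * \<bar>real_of_int (a i)\<bar>)))"
  proof (rule sum_mono)
    fix a assume "a \<in> A"
    moreover have "(\<Sum>i\<in>I. t i * \<bar>real_of_int (a i)\<bar>) \<le> (\<Sum>i\<in>I. t i * \<bar>real_of_int (a i)\<bar> powr p)"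
      using t abs_le by (intro sum_mono mult_left_mono) (auto intro: less_imp_le)
    ultimately show "1 \<le> exp (s - (\<Sum>i\<in>I. t i * \<bar>real_of_int (a i)\<bar>))"
      by (simp add: A_def)
  qed
  also have "\<dots> \<le> (\<Sum>a\<in>B. exp (s - (\<Sum>i\<in>I. t i * \<bar>real_of_int (a i)\<bar>)))"
    using finB sub by (intro sum_mono2) auto
  also have "\<dots> = exp s * (\<Sum>a\<in>B. \<Prod>i\<in>I. exp (- (t i * \<bar>real_of_int (a i)\<bar>)))"
    using I by (simp add: sum_distrib_left exp_diff exp_minus exp_sum divide_inverse prod_inversef[symmetric])
  also have "(\<Sum>a\<in>B. \<Prod>i\<in>I. exp (- (t i * \<bar>real_of_int (a i)\<bar>)))
      = (\<Prod>i\<in>I. \<Sum>c\<in>{- int L..int L}. exp (- (t i * \<bar>real_of_int c\<bar>)))"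
    unfolding B_def using I by (subst prod_sum_PiE) auto
  also have "exp s * \<dots> \<le> exp s * (\<Prod>i\<in>I. 1 + 2 / (exp (t i) - 1))"
    using t by (intro mult_left_mono prod_mono conjI sum_exp_neg_abs_int_le sum_nonneg) auto
  finally show "real (card A) \<le> exp s * (\<Prod>i\<in>I. 1 + 2 / (exp (t i) - 1))" .
qed

text \<open>
  Rounding toward 0 instead of to the nearest grid point keeps the error below \<open>\<bar>x\<bar>\<close> and does
  not enlarge the coordinate, so that rounding maps the unit ball into itself.
\<close>
lemma round_toward_zero:
  fixes x e :: real
  assumes "0 < e"
  obtains a :: int where "\<bar>real_of_int a\<bar> * e \<le> \<bar>x\<bar>" "\<bar>x - a * e\<bar> \<le> e" "\<bar>x - a * e\<bar> \<le> \<bar>x\<bar>"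
proof -
  define b where "b = \<lfloor>\<bar>x\<bar> / e\<rfloor>"
  have "0 \<le> b"
    using assms by (simp add: b_def)
  have "real_of_int b \<le> \<bar>x\<bar> / e" "\<bar>x\<bar> / e < real_of_int b + 1"
    unfolding b_def by linarith+
  then have b: "real_of_int b * e \<le> \<bar>x\<bar>" "\<bar>x\<bar> \<le> real_of_int b * e + e" "0 \<le> real_of_int b * e"
    using assms \<open>0 \<le> b\<close> by (auto simp: field_simps)
  show ?thesis
  proof (cases "0 \<le> x")
    case True
    with b \<open>0 \<le> b\<close> show ?thesis by (intro that[of b]) auto
  next
    case False
    with b \<open>0 \<le> b\<close> show ?thesis by (intro that[of "- b"]) auto
  qed
qed

text \<open>
  With these parameters the lattice count for the covering of the unit ball is exponential in
  \<open>m\<close> only. For \<open>i < m\<close> the factor is at most \<open>3 / t i\<close>, and the bound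
  \<open>m ^ m / fact m \<le> exp m\<close> from the exponential series absorbs the product of the \<open>m / Suc i\<close>. For larger \<open>i\<close> the factor
  differs from 1 by at most \<open>4 / (t i)\<^sup>2\<close>, and these bounds sum to at most \<open>4 * m\<close>.
\<close>
lemma prod_one_plus_inverse_expm1_le:
  fixes \<beta> :: real
  assumes m: "1 \<le> m" and \<beta>: "0 \<le> \<beta>"
  defines "t \<equiv> \<lambda>i. if i < m then (real (Suc i) / real m) powr \<beta> else real (Suc i) / real m"
  shows "(\<Prod>i<m\<^sup>2. 1 + 2 / (exp (t i) - 1)) \<le> exp ((6 + \<beta>) * real m)"
proof -
  have t0: "0 < t i" for i
    using m by (auto simp: t_def)
  have expm1: "t i \<le> exp (t i) - 1" "(t i)\<^sup>2 / 2 \<le> exp (t i) - 1" for i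
    using exp_lower_Taylor_quadratic[of "t i"] exp_ge_add_one_self[of "t i"] t0[of i] by linarith+
  have "(\<Prod>i<m. 1 + 2 / (exp (t i) - 1)) \<le> (\<Prod>i<m. 3 * (real m / real (Suc i)) powr \<beta>)"
  proof (intro prod_mono conjI)
    fix i assume "i \<in> {..<m}"
    then have i: "i < m" by simp
    have "t i \<le> 1"
      using i m \<beta> by (auto simp: t_def intro!: powr_le1)
    have "1 + 2 / (exp (t i) - 1) \<le> 1 / t i + 2 / t i"
      using t0[of i] expm1(1)[of i] \<open>t i \<le> 1\<close> by (intro add_mono divide_left_mono) auto
    also have "\<dots> = 3 * (real m / real (Suc i)) powr \<beta>"
      using i m by (simp add: t_def powr_divide field_simps)
    finally show "1 + 2 / (exp (t i) - 1) \<le> 3 * (real m / real (Suc i)) powr \<beta>" .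
  qed (use less_imp_le[OF t0] in \<open>auto intro!: add_nonneg_nonneg divide_nonneg_nonneg\<close>)
  also have "\<dots> = 3 ^ m * (\<Prod>i<m. real m / real (Suc i)) powr \<beta>"
    by (simp add: prod.distrib prod_powr_distrib)
  also have "(\<Prod>i<m. real m / real (Suc i)) = real m ^ m / fact m"
    by (simp add: prod_dividef fact_prod_Suc lessThan_atLeast0)
  also have "3 ^ m * (real m ^ m / fact m) powr \<beta> \<le> exp 2 ^ m * exp (real m) powr \<beta>"
  proof (intro mult_mono power_mono powr_mono2)
    show "(3::real) \<le> exp 2"
      using exp_ge_add_one_self[of 2] by simp
    show "real m ^ m / fact m \<le> exp (real m)"
    proof -
      have "(\<Sum>i\<in>{m}. inverse (fact i) * real m ^ i) \<le> (\<Sum>i. inverse (fact i) * real m ^ i)"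
        by (rule sum_le_suminf) (auto intro: summable_exp)
      then show ?thesis
        by (simp add: exp_def divide_inverse mult.commute)
    qed
  qed (use \<beta> in auto)
  also have "\<dots> = exp ((2 + \<beta>) * real m)"
    by (simp add: exp_of_nat_mult[symmetric] exp_add[symmetric] powr_def algebra_simps)
  finally have head: "(\<Prod>i<m. 1 + 2 / (exp (t i) - 1)) \<le> exp ((2 + \<beta>) * real m)" .
  have "(\<Prod>i\<in>{m..<m\<^sup>2}. 1 + 2 / (exp (t i) - 1)) \<le> (\<Prod>i\<in>{m..<m\<^sup>2}. exp (4 * (real m / real (Suc i)) powr 2))"
  proof (intro prod_mono conjI)
    fix i assume i: "i \<in> {m..<m\<^sup>2}"
    have "2 / (exp (t i) - 1) \<le> 2 / ((t i)\<^sup>2 / 2)"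
      using t0[of i] expm1[of i] by (intro divide_left_mono) (auto intro!: mult_pos_pos)
    also have "\<dots> = 4 * (real m / real (Suc i)) powr 2"
      using i m by (simp add: t_def power_divide field_simps)
    finally show "1 + 2 / (exp (t i) - 1) \<le> exp (4 * (real m / real (Suc i)) powr 2)"
      using exp_ge_add_one_self[of "4 * (real m / real (Suc i)) powr 2"] by linarith
  qed (use less_imp_le[OF t0] in \<open>auto intro!: add_nonneg_nonneg divide_nonneg_nonneg\<close>)
  also have "\<dots> = exp (4 * (\<Sum>i\<in>{m..<m\<^sup>2}. (real m / real (Suc i)) powr 2))"
    by (simp add: exp_sum sum_distrib_left)
  also have "\<dots> \<le> exp (4 * real m)"
    using sum_inverse_powr_tail_le[of 2 m "m\<^sup>2"] m by simp
  finally have tail: "(\<Prod>i\<in>{m..<m\<^sup>2}. 1 + 2 / (exp (t i) - 1)) \<le> exp (4 * real m)" .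
  have "m \<le> m\<^sup>2"
    using m by (simp add: power2_eq_square)
  then have "{..<m\<^sup>2} = {..<m} \<union> {m..<m\<^sup>2}"
    by auto
  then have "(\<Prod>i<m\<^sup>2. 1 + 2 / (exp (t i) - 1))
      = (\<Prod>i<m. 1 + 2 / (exp (t i) - 1)) * (\<Prod>i\<in>{m..<m\<^sup>2}. 1 + 2 / (exp (t i) - 1))"
    by (metis prod.union_disjoint finite_lessThan finite_atLeastLessThan ivl_disj_int_one(2) lessThan_atLeast0 ivl_disj_int_two(3))
  also have "\<dots> \<le> exp ((2 + \<beta>) * real m) * exp (4 * real m)"
    using head tail less_imp_le[OF t0] by (intro mult_mono prod_nonneg) (auto intro!: add_nonneg_nonneg divide_nonneg_nonneg)
  also have "\<dots> = exp ((6 + \<beta>) * real m)"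
    by (simp add: exp_add[symmetric] algebra_simps)
  finally show ?thesis .
qed


section \<open>Entropy numbers of the embedding\<close>

text \<open>
  An elementary substitute for Hoelder's inequality when the tail of an \<open>\<ell>\<^sub>p\<close> sequence is measured
  in a weighted \<open>\<ell>\<^sub>\<alpha>\<close> with \<open>\<alpha> < p\<close>: the threshold \<open>e\<close> may depend on the coordinate.
\<close>
lemma powr_le_powr_add_powr:
  fixes x e \<alpha> p :: real
  assumes "0 \<le> x" "0 < e" "0 < \<alpha>" "\<alpha> < p"
  shows "x powr \<alpha> \<le> x powr p * e powr (\<alpha> - p) + e powr \<alpha>"
proof (cases "x \<le> e")
  case True
  then have "x powr \<alpha> \<le> e powr \<alpha>"
    using assms by (intro powr_mono2) auto
  then show ?thesis by (simp add: add_increasing)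
next
  case False
  then have "x powr (\<alpha> - p) \<le> e powr (\<alpha> - p)"
    using assms by (intro powr_mono2') auto
  then have "x powr p * x powr (\<alpha> - p) \<le> x powr p * e powr (\<alpha> - p)"
    by (intro mult_left_mono) auto
  then have "x powr \<alpha> \<le> x powr p * e powr (\<alpha> - p)"
    by (simp add: powr_add[symmetric])
  then show ?thesis by (simp add: add_increasing2)
qed

context regular_weight
begin

text \<open>
  The mesh of the grid in coordinate \<open>k\<close> is \<open>(t / m) powr (1 / p)\<close>, where \<open>t\<close> is a power of
  \<open>k / m\<close> for \<open>k \<le> m\<close> and \<open>k / m\<close> itself beyond. The exponent of the power is chosen to cancel the
  polynomial growth of \<open>f k / f m\<close>. For \<open>k > m\<close> only \<open>f k \<le> (m / k) * f m\<close> is used. If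
  \<open>\<alpha> \<ge> p\<close>, the part \<open>\<alpha> - p\<close> of the exponent is spent on the mesh, and \<open>(\<alpha> - p) / p \<le> 1\<close> makes
  the factor \<open>m / k\<close> sufficient. If \<open>\<alpha> < p\<close>, the whole coordinate may be discarded, and the
  threshold of \<open>powr_le_powr_add_powr\<close> is chosen to decrease like \<open>(m / k) powr \<kappa>\<close> with
  \<open>\<kappa> * (p - \<alpha>) = 1\<close>. In the bound, both \<open>m * \<bar>x\<bar> powr p\<close> summed over the unit ball and the
  remaining weights summed over \<open>k\<close> are of order \<open>m\<close>.
\<close>
lemma weighted_rounding_error_le:
  fixes \<alpha> p :: real
  assumes \<alpha>: "0 < \<alpha>" "\<alpha> < 2" and p: "1 \<le> p"
  obtains \<rho> :: real where "1 < \<rho>"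
    and "\<And>m k x r. 1 \<le> m \<Longrightarrow> 1 \<le> k \<Longrightarrow>
      \<bar>r\<bar> \<le> (((if k \<le> m then (real k / real m) powr (growth_exponent * p / \<alpha>) else real k / real m)) / real m) powr (1 / p) \<Longrightarrow>
      \<bar>r\<bar> \<le> \<bar>x\<bar> \<Longrightarrow>
      f k * \<bar>r\<bar> powr \<alpha> \<le> R * f m * real m powr (- \<alpha> / p)
        * (real m * \<bar>x\<bar> powr p + (if k \<le> m then 1 else (real m / real k) powr \<rho>))"
proof -
  have head: "f k * \<bar>r\<bar> powr \<alpha> \<le> R * f m * real m powr (- \<alpha> / p) * (real m * \<bar>x\<bar> powr p + 1)"
    if m: "1 \<le> m" and k: "1 \<le> k" "k \<le> m"
      and r: "\<bar>r\<bar> \<le> ((real k / real m) powr (growth_exponent * p / \<alpha>) / real m) powr (1 / p)" for m k :: nat and x r :: real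
  proof -
    have "\<bar>r\<bar> powr \<alpha> \<le> (((real k / real m) powr (growth_exponent * p / \<alpha>) / real m) powr (1 / p)) powr \<alpha>"
      using r \<alpha> by (intro powr_mono2) auto
    also have "\<dots> = (real k / real m) powr growth_exponent * real m powr (- \<alpha> / p)"
      using \<alpha> p m k by (simp add: powr_powr powr_divide powr_minus powr_mult field_simps)
    finally have "f k * \<bar>r\<bar> powr \<alpha> \<le> (R * (real m / real k) powr growth_exponent * f m) * ((real k / real m) powr growth_exponent * real m powr (- \<alpha> / p))"
      using le_powr_ratio[OF k] two_le_R pos[OF m] by (intro mult_mono) auto
    also have "\<dots> = R * f m * real m powr (- \<alpha> / p) * 1"
      using m k by (simp add: powr_divide)
    also have "\<dots> \<le> R * f m * real m powr (- \<alpha> / p) * (real m * \<bar>x\<bar> powr p + 1)"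
      using two_le_R pos[OF m] by (intro mult_left_mono) auto
    finally show ?thesis .
  qed
  have f_le: "f k \<le> real m / real k * f m" if "1 \<le> m" "m \<le> k" for m k
    using decreasing[OF that] that by (simp add: field_simps)
  have scale: "c \<le> R * c" if "0 \<le> c" for c
    using two_le_R that mult_right_mono[of 1 R c] by simp
  show ?thesis
  proof (cases "\<alpha> < p")
    case True
    define \<kappa> where "\<kappa> = 1 / (p - \<alpha>)"
    have \<kappa>: "0 < \<kappa>" "\<kappa> * (p - \<alpha>) = 1"
      using True by (auto simp: \<kappa>_def)
    have tail: "f k * \<bar>r\<bar> powr \<alpha> \<le> R * f m * real m powr (- \<alpha> / p)
        * (real m * \<bar>x\<bar> powr p + (real m / real k) powr (1 + \<kappa> * \<alpha>))"
      if m: "1 \<le> m" and k: "m < k" and r: "\<bar>r\<bar> \<le> \<bar>x\<bar>" for m k :: nat and x r :: real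
    proof -
      define e where "e = real m powr (- 1 / p) * (real m / real k) powr \<kappa>"
      have e: "0 < e"
        using m k by (simp add: e_def)
      have ea: "e powr \<alpha> = real m powr (- \<alpha> / p) * (real m / real k) powr (\<kappa> * \<alpha>)"
        by (simp add: e_def powr_mult powr_powr)
      have "e powr (\<alpha> - p) = real m powr ((p - \<alpha>) / p) * (real m / real k) powr (- (\<kappa> * (p - \<alpha>)))"
      proof -
        have "(- 1 / p) * (\<alpha> - p) = (p - \<alpha>) / p" "\<kappa> * (\<alpha> - p) = - (\<kappa> * (p - \<alpha>))"
          using p by (simp_all add: field_simps)
        then show ?thesis
          unfolding e_def powr_mult powr_powr by presburger
      qed
      also have "\<dots> = real m powr (- \<alpha> / p) * real m * (real k / real m)"
      proof -
        have "(p - \<alpha>) / p = - \<alpha> / p + 1"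
          using p by (simp add: field_simps)
        then show ?thesis
          using \<kappa>(2) m k by (simp add: powr_diff powr_minus divide_inverse)
      qed
      finally have ep: "e powr (\<alpha> - p) = real m powr (- \<alpha> / p) * real m * (real k / real m)" .
      have "\<bar>r\<bar> powr \<alpha> \<le> \<bar>x\<bar> powr \<alpha>"
        using r \<alpha> by (intro powr_mono2) auto
      also have "\<dots> \<le> \<bar>x\<bar> powr p * e powr (\<alpha> - p) + e powr \<alpha>"
        using e \<alpha> True by (intro powr_le_powr_add_powr) auto
      finally have "f k * \<bar>r\<bar> powr \<alpha> \<le> (real m / real k * f m) * (\<bar>x\<bar> powr p * e powr (\<alpha> - p) + e powr \<alpha>)"
        using f_le[of m k] m k pos[OF m] by (intro mult_mono) auto
      also have "\<dots> = f m * real m powr (- \<alpha> / p) * (real m * \<bar>x\<bar> powr p + (real m / real k) powr (1 + \<kappa> * \<alpha>))"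
        using m k unfolding ea ep by (simp add: powr_add field_simps)
      also have "\<dots> \<le> R * (f m * real m powr (- \<alpha> / p) * (real m * \<bar>x\<bar> powr p + (real m / real k) powr (1 + \<kappa> * \<alpha>)))"
        using pos[OF m] by (intro scale mult_nonneg_nonneg add_nonneg_nonneg) auto
      finally show ?thesis by (simp add: mult.assoc)
    qed
    show ?thesis
      using \<kappa> \<alpha> head tail by (intro that[of "1 + \<kappa> * \<alpha>"]) (auto simp: not_le)
  next
    case False
    define \<theta> where "\<theta> = (\<alpha> - p) / p"
    have \<theta>: "0 \<le> \<theta>" "\<theta> \<le> 1"
      using False \<alpha> p by (auto simp: \<theta>_def field_simps)
    have tail: "f k * \<bar>r\<bar> powr \<alpha> \<le> R * f m * real m powr (- \<alpha> / p)
        * (real m * \<bar>x\<bar> powr p + (real m / real k) powr 2)"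
      if m: "1 \<le> m" and k: "m < k" and r: "\<bar>r\<bar> \<le> \<bar>x\<bar>" "\<bar>r\<bar> \<le> (real k / real m / real m) powr (1 / p)"
      for m k :: nat and x r :: real
    proof -
      have "\<bar>r\<bar> powr \<alpha> = \<bar>r\<bar> powr p * \<bar>r\<bar> powr (\<alpha> - p)"
        by (simp add: powr_add[symmetric])
      also have "\<dots> \<le> \<bar>x\<bar> powr p * ((real k / real m / real m) powr (1 / p)) powr (\<alpha> - p)"
        using r False p by (intro mult_mono powr_mono2) auto
      also have "((real k / real m / real m) powr (1 / p)) powr (\<alpha> - p)
          = (real k / real m) powr \<theta> * real m powr (- \<theta>)"
        using m k by (simp add: powr_powr \<theta>_def powr_divide powr_minus powr_mult field_simps)
      also have "(real k / real m) powr \<theta> \<le> real k / real m"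
        using powr_mono[of \<theta> 1 "real k / real m"] \<theta> m k by simp
      also have "real m powr (- \<theta>) = real m powr (- \<alpha> / p) * real m"
      proof -
        have "- \<theta> = - \<alpha> / p + 1"
          using p by (simp add: \<theta>_def field_simps)
        then show ?thesis
          using m by (simp add: powr_diff powr_minus divide_inverse)
      qed
      finally have "\<bar>r\<bar> powr \<alpha> \<le> \<bar>x\<bar> powr p * (real k / real m * (real m powr (- \<alpha> / p) * real m))"
        using m by (simp add: mult_left_mono mult_right_mono)
      then have "f k * \<bar>r\<bar> powr \<alpha> \<le> (real m / real k * f m) * (\<bar>x\<bar> powr p * (real k / real m * (real m powr (- \<alpha> / p) * real m)))"
        using f_le[of m k] m k pos[OF m] by (intro mult_mono) auto
      also have "\<dots> = f m * real m powr (- \<alpha> / p) * (real m * \<bar>x\<bar> powr p)"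
        using m k by (simp add: field_simps)
      also have "\<dots> \<le> f m * real m powr (- \<alpha> / p) * (real m * \<bar>x\<bar> powr p + (real m / real k) powr 2)"
        using pos[OF m] by (intro mult_left_mono mult_nonneg_nonneg) auto
      also have "\<dots> \<le> R * (f m * real m powr (- \<alpha> / p) * (real m * \<bar>x\<bar> powr p + (real m / real k) powr 2))"
        using pos[OF m] by (intro scale mult_nonneg_nonneg add_nonneg_nonneg) auto
      finally show ?thesis by (simp add: mult.assoc)
    qed
    show ?thesis
      using head tail by (intro that[of 2]) (auto simp: not_le)
  qed
qed

end

lemma sum_rounding_weights_le:
  fixes \<rho> :: real
  assumes "1 < \<rho>" "1 \<le> m"
  shows "(\<Sum>i<n. if Suc i \<le> m then 1 else (real m / real (Suc i)) powr \<rho>) \<le> real m + real m / (\<rho> - 1)"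
proof -
  let ?w = "\<lambda>i. if Suc i \<le> m then 1 else (real m / real (Suc i)) powr \<rho>"
  have "(\<Sum>i<n. ?w i) \<le> (\<Sum>i\<in>{..<m} \<union> {m..<n}. ?w i)"
    by (intro sum_mono2) auto
  also have "\<dots> = (\<Sum>i<m. ?w i) + (\<Sum>i\<in>{m..<n}. ?w i)"
    by (intro sum.union_disjoint) auto
  also have "(\<Sum>i<m. ?w i) = real m"
    by simp
  also have "(\<Sum>i\<in>{m..<n}. ?w i) = (\<Sum>i\<in>{m..<n}. (real m / real (Suc i)) powr \<rho>)"
    by (intro sum.cong) auto
  also have "\<dots> \<le> real m / (\<rho> - 1)"
    using assms by (rule sum_inverse_powr_tail_le)
  finally show ?thesis by simp
qed

context regular_weight
begin

text \<open>
  The centres are the grid points with the mesh sizes of \<open>weighted_rounding_error_le\<close>. Only the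
  first \<open>m\<^sup>2\<close> coordinates matter: beyond them the mesh exceeds 1, so that every coordinate of a
  point of the unit ball is rounded to 0.
\<close>
lemma ell_unit_ball_covering:
  fixes \<alpha> p :: real
  assumes \<alpha>: "0 < \<alpha>" "\<alpha> < 2" and p: "1 \<le> p"
  obtains C :: real where "0 < C"
    and "\<And>m. 1 \<le> m \<Longrightarrow> \<exists>Y. finite Y \<and> Y \<noteq> {} \<and> real (card Y) \<le> exp (C * real m) \<and>
      (\<forall>y\<in>Y. finite {k. y k \<noteq> 0}) \<and>
      (\<forall>z\<in>ell p. ell_norm p z \<le> 1 \<longrightarrow> (\<exists>y\<in>Y.
        (\<Sum>k. ennreal (f (Suc k) * \<bar>z k - y k\<bar> powr \<alpha>)) \<le> ennreal (C * f m * real m powr (1 - \<alpha> / p))))"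
proof -
  obtain \<rho> :: real where \<rho>: "1 < \<rho>"
    and err: "\<And>m k x r. 1 \<le> m \<Longrightarrow> 1 \<le> k \<Longrightarrow>
      \<bar>r\<bar> \<le> (((if k \<le> m then (real k / real m) powr (growth_exponent * p / \<alpha>) else real k / real m)) / real m) powr (1 / p) \<Longrightarrow>
      \<bar>r\<bar> \<le> \<bar>x\<bar> \<Longrightarrow>
      f k * \<bar>r\<bar> powr \<alpha> \<le> R * f m * real m powr (- \<alpha> / p)
        * (real m * \<bar>x\<bar> powr p + (if k \<le> m then 1 else (real m / real k) powr \<rho>))"
    using weighted_rounding_error_le[OF \<alpha> p] by blast
  define \<beta> where "\<beta> = growth_exponent * p / \<alpha>"
  have \<beta>: "0 \<le> \<beta>"
    using growth_exponent_ge_1 \<alpha> p by (simp add: \<beta>_def)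
  define C where "C = max (7 + \<beta>) (R * (2 + 1 / (\<rho> - 1)))"
  show ?thesis
  proof (rule that)
    show "0 < C"
      using \<beta> by (simp add: C_def)
  next
    fix m :: nat assume m: "1 \<le> m"
    define t where "t = (\<lambda>i. if i < m then (real (Suc i) / real m) powr \<beta> else real (Suc i) / real m)"
    define e where "e = (\<lambda>i. (t i / real m) powr (1 / p))"
    have t0: "0 < t i" for i
      using m by (auto simp: t_def)
    have e0: "0 < e i" for i
      using t0[of i] m by (simp add: e_def)
    have ep: "e i powr p = t i / real m" for i
      using t0[of i] m p by (simp add: e_def powr_powr)
    have e_large: "1 \<le> e i" if "m\<^sup>2 \<le> i" for i
    proof -
      have "m \<le> m\<^sup>2"
        using m by (simp add: power2_eq_square)
      then have "t i = real (Suc i) / real m"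
        using that by (simp add: t_def)
      moreover have "real m * real m \<le> real (Suc i)"
        using that by (simp add: power2_eq_square flip: of_nat_mult)
      ultimately have "real m \<le> t i"
        using m by (simp add: pos_le_divide_eq)
      then have "1 \<le> t i / real m"
        using m by simp
      then show ?thesis
        using p by (simp add: e_def ge_one_powr_ge_zero)
    qed
    define A where "A = {a \<in> {..<m\<^sup>2} \<rightarrow>\<^sub>E (UNIV :: int set). (\<Sum>i<m\<^sup>2. t i * \<bar>real_of_int (a i)\<bar> powr p) \<le> real m}"
    define Y where "Y = (\<lambda>a k. if k < m\<^sup>2 then real_of_int (a k) * e k else 0) ` A"
    have finA: "finite A"
      unfolding A_def using t0 p by (intro card_lattice_points_le(1)) auto
    have "real (card Y) \<le> real (card A)"
      unfolding Y_def using finA by (simp add: card_image_le)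
    also have "\<dots> \<le> exp (real m) * (\<Prod>i<m\<^sup>2. 1 + 2 / (exp (t i) - 1))"
      unfolding A_def using t0 p by (intro card_lattice_points_le(2)) auto
    also have "\<dots> \<le> exp (real m) * exp ((6 + \<beta>) * real m)"
      using prod_one_plus_inverse_expm1_le[OF m \<beta>] by (intro mult_left_mono) (simp_all add: t_def)
    also have "\<dots> = exp ((7 + \<beta>) * real m)"
      by (simp add: exp_add[symmetric] algebra_simps)
    also have "\<dots> \<le> exp (C * real m)"
      by (simp add: C_def mult_right_mono)
    finally have cardY: "real (card Y) \<le> exp (C * real m)" .
    have cover: "\<exists>y\<in>Y. (\<Sum>k. ennreal (f (Suc k) * \<bar>z k - y k\<bar> powr \<alpha>)) \<le> ennreal (C * f m * real m powr (1 - \<alpha> / p))"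
      if z: "z \<in> ell p" "ell_norm p z \<le> 1" for z
    proof -
      have summ: "summable (\<lambda>k. \<bar>z k\<bar> powr p)"
        using z(1) by (simp add: ell_def)
      have "(\<Sum>k. \<bar>z k\<bar> powr p) = ell_norm p z powr p"
        using p summ by (simp add: ell_norm_def powr_powr suminf_nonneg)
      also have "\<dots> \<le> 1"
        using z(2) p by (intro powr_le1) (auto simp: ell_norm_def)
      finally have sum_le: "(\<Sum>k\<in>I. \<bar>z k\<bar> powr p) \<le> 1" if "finite I" for I
        using sum_le_suminf[OF summ that] by simp
      have "\<forall>i. \<exists>a::int. \<bar>real_of_int a\<bar> * e i \<le> \<bar>z i\<bar> \<and>
          \<bar>z i - a * e i\<bar> \<le> e i \<and> \<bar>z i - a * e i\<bar> \<le> \<bar>z i\<bar>"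
        by (metis round_toward_zero[OF e0])
      then obtain a :: "nat \<Rightarrow> int" where a: "\<And>i. \<bar>real_of_int (a i)\<bar> * e i \<le> \<bar>z i\<bar>"
        "\<And>i. \<bar>z i - real_of_int (a i) * e i\<bar> \<le> e i" "\<And>i. \<bar>z i - real_of_int (a i) * e i\<bar> \<le> \<bar>z i\<bar>"
        by metis
      define y where "y = (\<lambda>k. if k < m\<^sup>2 then real_of_int (a k) * e k else 0)"
      have "(\<Sum>i<m\<^sup>2. t i * \<bar>real_of_int (a i)\<bar> powr p) = real m * (\<Sum>i<m\<^sup>2. (\<bar>real_of_int (a i)\<bar> * e i) powr p)"
        using m e0 by (simp add: sum_distrib_left powr_mult less_imp_le ep mult.commute)
      also have "\<dots> \<le> real m * (\<Sum>i<m\<^sup>2. \<bar>z i\<bar> powr p)"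
        using a(1) e0 p by (intro mult_left_mono sum_mono powr_mono2) (auto simp: less_imp_le)
      also have "\<dots> \<le> real m"
        using mult_left_mono[OF sum_le[of "{..<m\<^sup>2}"], of "real m"] by simp
      finally have "restrict a {..<m\<^sup>2} \<in> A"
        by (simp add: A_def)
      then have yY: "y \<in> Y"
        unfolding Y_def y_def by (intro image_eqI) auto
      have z1: "\<bar>z k\<bar> \<le> 1" for k
        using evaluation_bound[of p z k] z p by (simp add: embedding_def)
      have r: "\<bar>z k - y k\<bar> \<le> e k" "\<bar>z k - y k\<bar> \<le> \<bar>z k\<bar>" for k
        using a(2,3)[of k] e_large[of k] z1[of k] by (auto simp: y_def)
      let ?w = "\<lambda>i. if Suc i \<le> m then 1 else (real m / real (Suc i)) powr \<rho>"
      let ?B = "R * f m * real m powr (- \<alpha> / p)"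
      have B: "0 \<le> ?B"
        using two_le_R pos[OF m] by simp
      have pt: "f (Suc k) * \<bar>z k - y k\<bar> powr \<alpha> \<le> ?B * (real m * \<bar>z k\<bar> powr p + ?w k)" for k
        using err[of m "Suc k" "z k - y k" "z k", folded \<beta>_def] r[of k, unfolded e_def t_def] m
        by (simp only: Suc_le_eq One_nat_def zero_less_Suc simp_thms)
      have part: "(\<Sum>k<n. f (Suc k) * \<bar>z k - y k\<bar> powr \<alpha>) \<le> C * f m * real m powr (1 - \<alpha> / p)" for n
      proof -
        have "(\<Sum>k<n. f (Suc k) * \<bar>z k - y k\<bar> powr \<alpha>) \<le> (\<Sum>k<n. ?B * (real m * \<bar>z k\<bar> powr p + ?w k))"
          by (intro sum_mono pt)
        also have "\<dots> = ?B * (real m * (\<Sum>k<n. \<bar>z k\<bar> powr p) + (\<Sum>k<n. ?w k))"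
          by (simp only: sum_distrib_left sum.distrib distrib_left)
        also have "\<dots> \<le> ?B * (real m * 1 + (real m + real m / (\<rho> - 1)))"
          using sum_le[of "{..<n}"] sum_rounding_weights_le[OF \<rho> m, of n] B
          by (intro mult_left_mono add_mono) auto
        also have "\<dots> = (R * (2 + 1 / (\<rho> - 1))) * (f m * (real m powr (- \<alpha> / p) * real m))"
          by (simp add: field_simps)
        also have "real m powr (- \<alpha> / p) * real m = real m powr (1 - \<alpha> / p)"
          using m by (simp add: powr_diff powr_minus field_simps)
        also have "(R * (2 + 1 / (\<rho> - 1))) * (f m * real m powr (1 - \<alpha> / p)) \<le> C * (f m * real m powr (1 - \<alpha> / p))"
          using pos[OF m] by (intro mult_right_mono) (auto simp: C_def)
        finally show ?thesis by (simp add: mult.assoc)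
      qed
      have "(\<Sum>k. ennreal (f (Suc k) * \<bar>z k - y k\<bar> powr \<alpha>)) \<le> ennreal (C * f m * real m powr (1 - \<alpha> / p))"
      proof (rule suminf_le_const[OF summableI])
        fix n
        have "(\<Sum>k<n. ennreal (f (Suc k) * \<bar>z k - y k\<bar> powr \<alpha>)) = ennreal (\<Sum>k<n. f (Suc k) * \<bar>z k - y k\<bar> powr \<alpha>)"
          using pos by (intro sum_ennreal) (simp add: less_imp_le)
        also have "\<dots> \<le> ennreal (C * f m * real m powr (1 - \<alpha> / p))"
          by (intro ennreal_leI part)
        finally show "(\<Sum>k<n. ennreal (f (Suc k) * \<bar>z k - y k\<bar> powr \<alpha>)) \<le> ennreal (C * f m * real m powr (1 - \<alpha> / p))" .
      qed
      with yY show ?thesis by blast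
    qed
    have "(\<lambda>_. 0) \<in> ell p" "ell_norm p (\<lambda>_. 0) \<le> 1"
      using p by (auto simp: ell_def ell_norm_def)
    then have "Y \<noteq> {}"
      using cover by blast
    moreover have "finite {k. y k \<noteq> 0}" if "y \<in> Y" for y
      using that by (auto simp: Y_def intro: finite_subset[of _ "{..<m\<^sup>2}"])
    moreover have "finite Y"
      using finA by (simp add: Y_def)
    ultimately show "\<exists>Y. finite Y \<and> Y \<noteq> {} \<and> real (card Y) \<le> exp (C * real m) \<and>
      (\<forall>y\<in>Y. finite {k. y k \<noteq> 0}) \<and>
      (\<forall>z\<in>ell p. ell_norm p z \<le> 1 \<longrightarrow> (\<exists>y\<in>Y.
        (\<Sum>k. ennreal (f (Suc k) * \<bar>z k - y k\<bar> powr \<alpha>)) \<le> ennreal (C * f m * real m powr (1 - \<alpha> / p))))"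
      using cardY cover by blast
  qed
qed

end

lemma entropy_number_leI:
  assumes "finite Y" "Y \<noteq> {}" "card Y \<le> 2 ^ (n - 1)" "Y \<subseteq> F" "0 < \<epsilon>"
    and "\<And>z. z \<in> E \<Longrightarrow> normE z \<le> 1 \<Longrightarrow> w z \<in> F \<and> (\<exists>y\<in>Y. normF (w z - y) \<le> \<epsilon>)"
  shows "entropy_number E normE F normF w n \<le> ereal \<epsilon>"
proof -
  obtain h where h: "bij_betw h {1..card Y} Y"
    using ex_bij_betw_nat_finite_1[OF assms(1)] by blast
  define y where "y i = (if i \<le> card Y then h i else h 1)" for i
  have card: "1 \<le> card Y"
    using assms(1,2) by (simp add: Suc_le_eq card_gt_0_iff)
  have "y i \<in> F" if "i \<in> {1..2 ^ (n - 1)}" for i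
    using bij_betwE[OF h] card that assms(4) by (auto simp: y_def)
  moreover have "\<exists>i\<in>{1..2 ^ (n - 1)}. normF (w z - y i) \<le> \<epsilon>" if z: "z \<in> E" "normE z \<le> 1" for z
  proof -
    obtain x where "x \<in> Y" "normF (w z - x) \<le> \<epsilon>"
      using assms(6)[OF z] by blast
    moreover from this have "x \<in> h ` {1..card Y}"
      using bij_betw_imp_surj_on[OF h] by simp
    then obtain i where "i \<in> {1..card Y}" "h i = x"
      by blast
    ultimately show ?thesis
      using assms(3) by (intro bexI[of _ i]) (auto simp: y_def)
  qed
  ultimately show ?thesis
    unfolding entropy_number_def using assms(5,6) by (intro Inf_lower) blast
qed

text \<open>
  The covering with parameter \<open>m\<close> has at most \<open>exp (C * m)\<close> centres, so it is used with
  \<open>m = n div K\<close> for a large constant \<open>K\<close>; the polynomial bounds on \<open>f\<close> allow to replace \<open>m\<close>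
  by \<open>n\<close> in the radius at the cost of a constant.
\<close>
lemma (in regular_weight) entropy_number_embedding_le:
  fixes \<alpha> p :: real and P :: "nat pmf"
  assumes \<alpha>: "0 < \<alpha>" "\<alpha> < 2" and p: "1 \<le> p" and P: "\<And>i. pmf P i = f (Suc i)"
  obtains C n0 where "0 < C"
    and "\<And>n. n0 \<le> n \<Longrightarrow>
      entropy_number (ell p) (ell_norm p) (Lspace \<alpha> (measure_pmf P)) (Lspace_norm \<alpha> (measure_pmf P)) embedding n
        \<le> ereal (C * f n powr (1 / \<alpha>) * real n powr (1 / \<alpha> - 1 / p))"
proof -
  obtain C :: real where C: "0 < C"
    and cover: "\<And>m. 1 \<le> m \<Longrightarrow> \<exists>Y. finite Y \<and> Y \<noteq> {} \<and> real (card Y) \<le> exp (C * real m) \<and>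
      (\<forall>y\<in>Y. finite {k. y k \<noteq> 0}) \<and>
      (\<forall>z\<in>ell p. ell_norm p z \<le> 1 \<longrightarrow> (\<exists>y\<in>Y.
        (\<Sum>k. ennreal (f (Suc k) * \<bar>z k - y k\<bar> powr \<alpha>)) \<le> ennreal (C * f m * real m powr (1 - \<alpha> / p))))"
    by (rule ell_unit_ball_covering[OF \<alpha> p], rule that)
  define K where "K = nat \<lceil>4 * C\<rceil> + 2"
  have K: "2 \<le> K" "4 * C \<le> real K"
    unfolding K_def by linarith+
  let ?c = "1 / \<alpha> - 1 / p"
  define D where "D = (C * (R * (2 * real K) powr growth_exponent)) powr (1 / \<alpha>) * (2 * real K) powr \<bar>?c\<bar>"
  show ?thesis
  proof (rule that)
    show "0 < D"
      using C K two_le_R by (simp add: D_def)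
  next
    fix n assume n: "K \<le> n"
    define m where "m = n div K"
    have m: "1 \<le> m" "m \<le> n" "m * K \<le> n" "n < 2 * K * m"
    proof -
      show m1: "1 \<le> m"
        using n K div_le_mono[OF n, of K] by (simp add: m_def)
      show "m \<le> n" "m * K \<le> n"
        by (auto simp: m_def)
      have "n < K * m + K"
        using K mult_div_mod_eq[of K n] mod_less_divisor[of K n] unfolding m_def by linarith
      moreover have "K \<le> K * m"
        using m1 by simp
      ultimately show "n < 2 * K * m" by linarith
    qed
    define \<epsilon> where "\<epsilon> = (C * f m * real m powr (1 - \<alpha> / p)) powr (1 / \<alpha>)"
    have fm: "0 < f m"
      using pos m by simp
    then have e0: "0 < \<epsilon>"
      using C m by (simp add: \<epsilon>_def)
    obtain Y where Y: "finite Y" "Y \<noteq> {}" "real (card Y) \<le> exp (C * real m)"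
      "\<And>y. y \<in> Y \<Longrightarrow> finite {k. y k \<noteq> 0}"
      and cov: "\<And>z. z \<in> ell p \<Longrightarrow> ell_norm p z \<le> 1 \<Longrightarrow> \<exists>y\<in>Y.
        (\<Sum>k. ennreal (f (Suc k) * \<bar>z k - y k\<bar> powr \<alpha>)) \<le> ennreal (C * f m * real m powr (1 - \<alpha> / p))"
      using cover[OF m(1)] by blast
    have "card Y \<le> 2 ^ (n - 1)"
    proof -
      have "4 * C * real m \<le> real K * real m"
        using K m by (intro mult_right_mono) auto
      also have "\<dots> \<le> real n"
        using m(3) by (simp flip: of_nat_mult add: mult.commute)
      finally have "C * real m \<le> real n / 4"
        by simp
      also have "\<dots> \<le> real (n - 1) * (1 / 2)"
        using n K by simp
      also have "\<dots> \<le> real (n - 1) * ln 2"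
        using ln2_ge_two_thirds by (intro mult_left_mono) auto
      finally have "exp (C * real m) \<le> exp (real (n - 1) * ln 2)"
        by simp
      also have "\<dots> = 2 ^ (n - 1)"
        by (subst exp_of_nat_mult) simp
      finally have "real (card Y) \<le> 2 ^ (n - 1)"
        using Y(3) by (rule order.trans[rotated])
      then show ?thesis
        by simp
    qed
    moreover have emb: "embedding z \<in> Lspace \<alpha> (measure_pmf P)" if "z \<in> ell p" for z
      using that \<alpha> p by (intro embedding_in_Lspace) (auto intro: measure_pmf.finite_measure_axioms)
    have "Y \<subseteq> Lspace \<alpha> (measure_pmf P)"
    proof
      fix y assume "y \<in> Y"
      then have "y \<in> ell p"
        using p unfolding ell_def by (auto intro!: summable_finite[OF Y(4)])
      then show "y \<in> Lspace \<alpha> (measure_pmf P)"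
        using emb[of y] by (simp add: embedding_def)
    qed
    moreover have "\<exists>y\<in>Y. Lspace_norm \<alpha> (measure_pmf P) (embedding z - y) \<le> \<epsilon>"
      if z: "z \<in> ell p" "ell_norm p z \<le> 1" for z
    proof -
      obtain y where y: "y \<in> Y"
        "(\<Sum>k. ennreal (f (Suc k) * \<bar>z k - y k\<bar> powr \<alpha>)) \<le> ennreal (C * f m * real m powr (1 - \<alpha> / p))"
        using cov[OF z] by blast
      have "(\<integral>\<^sup>+k. ennreal (\<bar>z k - y k\<bar> powr \<alpha>) \<partial>measure_pmf P)
          = (\<Sum>k. ennreal (f (Suc k) * \<bar>z k - y k\<bar> powr \<alpha>))"
        using pos by (simp add: nn_integral_measure_pmf nn_integral_count_space_nat P ennreal_mult less_imp_le)
      with y(2) have "(\<integral>\<^sup>+k. ennreal (\<bar>z k - y k\<bar> powr \<alpha>) \<partial>measure_pmf P)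
          \<le> ennreal (C * f m * real m powr (1 - \<alpha> / p))"
        by simp
      then have "(LINT k|measure_pmf P. \<bar>z k - y k\<bar> powr \<alpha>) \<le> C * f m * real m powr (1 - \<alpha> / p)"
        using C fm by (intro integral_real_bounded) auto
      then have "Lspace_norm \<alpha> (measure_pmf P) (embedding z - y) \<le> \<epsilon>"
        unfolding Lspace_norm_def \<epsilon>_def embedding_def fun_diff_def
        using \<alpha> by (intro powr_mono2) (auto intro!: integral_nonneg_AE)
      with y(1) show ?thesis by blast
    qed
    ultimately have "entropy_number (ell p) (ell_norm p) (Lspace \<alpha> (measure_pmf P)) (Lspace_norm \<alpha> (measure_pmf P)) embedding n \<le> ereal \<epsilon>"
      using Y(1,2) e0 emb by (intro entropy_number_leI[of Y]) auto
    also have "\<epsilon> \<le> D * f n powr (1 / \<alpha>) * real n powr ?c"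
    proof -
      have ratio: "real n / real m \<le> 2 * real K" "1 \<le> real n / real m"
      proof -
        have "real n \<le> real (2 * K * m)"
          using m(4) by (simp only: of_nat_le_iff less_imp_le)
        then show "real n / real m \<le> 2 * real K" "1 \<le> real n / real m"
          using m by (simp_all add: field_simps)
      qed
      have "f m \<le> R * (real n / real m) powr growth_exponent * f n"
        using m by (intro le_powr_ratio) auto
      also have "\<dots> \<le> R * (2 * real K) powr growth_exponent * f n"
        using ratio two_le_R growth_exponent_ge_1 pos[of n] m by (intro mult_right_mono mult_left_mono powr_mono2) auto
      finally have "(C * f m) powr (1 / \<alpha>) \<le> (C * (R * (2 * real K) powr growth_exponent * f n)) powr (1 / \<alpha>)"
        using C fm \<alpha> by (intro powr_mono2 mult_left_mono) auto
      also have "\<dots> = (C * (R * (2 * real K) powr growth_exponent)) powr (1 / \<alpha>) * f n powr (1 / \<alpha>)"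
        by (simp add: powr_mult mult.assoc)
      finally have 1: "(C * f m) powr (1 / \<alpha>) \<le> (C * (R * (2 * real K) powr growth_exponent)) powr (1 / \<alpha>) * f n powr (1 / \<alpha>)" .
      have "(real m / real n) powr ?c = (real n / real m) powr (- ?c)"
        using m by (simp add: powr_divide powr_minus powr_diff field_simps)
      also have "\<dots> \<le> (real n / real m) powr \<bar>?c\<bar>"
        using ratio by (intro powr_mono) auto
      also have "\<dots> \<le> (2 * real K) powr \<bar>?c\<bar>"
        using ratio by (intro powr_mono2) auto
      finally have 2: "(real m / real n) powr ?c \<le> (2 * real K) powr \<bar>?c\<bar>" .
      have "(1 - \<alpha> / p) * (1 / \<alpha>) = ?c"
        using \<alpha> p by (simp add: field_simps)
      then have "\<epsilon> = (C * f m) powr (1 / \<alpha>) * real m powr ?c"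
        unfolding \<epsilon>_def by (simp add: powr_mult powr_powr)
      also have "real m powr ?c = (real m / real n) powr ?c * real n powr ?c"
        using m by (simp add: powr_divide)
      also have "(C * f m) powr (1 / \<alpha>) * \<dots>
          \<le> ((C * (R * (2 * real K) powr growth_exponent)) powr (1 / \<alpha>) * f n powr (1 / \<alpha>)) * ((2 * real K) powr \<bar>?c\<bar> * real n powr ?c)"
        using 1 2 by (intro mult_mono) auto
      finally show ?thesis by (simp add: D_def ac_simps)
    qed
    finally show "entropy_number (ell p) (ell_norm p) (Lspace \<alpha> (measure_pmf P)) (Lspace_norm \<alpha> (measure_pmf P)) embedding n
        \<le> ereal (D * f n powr (1 / \<alpha>) * real n powr ?c)" by simp
  qed
qed


section \<open>A lower bound for entropy numbers of coordinate operators\<close>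

text \<open>
  A Hamming ball of radius \<open>n / 2\<close> in a cube of dimension \<open>4 * n\<close>. Giving each element the weight
  1/16, a set in the ball has weight at least \<open>4 ^ (- n)\<close>, while the total weight is
  \<open>(17 / 16) ^ (4 * n) \<le> 2 ^ n\<close>.
\<close>
lemma card_small_subsets_le:
  assumes J: "finite J" and cJ: "card J = 4 * n"
  shows "card {D \<in> Pow J. 2 * card D \<le> n} \<le> 8 ^ n"
proof -
  let ?S = "{D \<in> Pow J. 2 * card D \<le> n}"
  have fin: "finite ?S"
    using J by simp
  have "(1 / 4) ^ n * real (card ?S) = (\<Sum>D\<in>?S. (1 / 4) ^ n)"
    by simp
  also have "\<dots> \<le> (\<Sum>D\<in>?S. (1 / 16 :: real) ^ card D)"
  proof (rule sum_mono)
    fix D assume "D \<in> ?S"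
    then have "(1 / 4 :: real) ^ n \<le> (1 / 4) ^ (2 * card D)"
      by (intro power_decreasing) auto
    then show "(1 / 4 :: real) ^ n \<le> (1 / 16) ^ card D"
      by (simp add: power_mult power2_eq_square)
  qed
  also have "\<dots> \<le> (\<Sum>D\<in>Pow J. (1 / 16 :: real) ^ card D)"
    using J by (intro sum_mono2) auto
  also have "\<dots> = (\<Prod>x\<in>J. 1 / 16 + 1)"
    by (subst prod_add[OF J]) simp
  also have "\<dots> = ((17 / 16) ^ 4) ^ n"
    by (simp add: cJ power_mult)
  also have "\<dots> \<le> 2 ^ n"
    by (intro power_mono) (simp_all add: power_divide)
  finally have "real (card ?S) \<le> 4 ^ n * 2 ^ n"
    by (simp add: power_divide field_simps)
  also have "\<dots> = real (8 ^ n)"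
    by (simp add: power_mult_distrib[symmetric])
  finally show ?thesis
    by linarith
qed

text \<open>
  By pigeonhole, one class contains at least \<open>16 ^ n / 2 ^ (n - 1) = 2 * 8 ^ n\<close> subsets, more than
  a Hamming ball around any of them.
\<close>
lemma far_subsets_in_same_class:
  assumes J: "finite J" and cJ: "card J = 4 * n" and n: "1 \<le> n"
    and c: "\<And>B. B \<subseteq> J \<Longrightarrow> c B \<in> {1..2 ^ (n - 1) :: nat}"
  obtains A B where "A \<subseteq> J" "B \<subseteq> J" "c A = c B" "n < 2 * card (sym_diff A B)"
proof -
  have "c \<in> Pow J \<rightarrow> {1..2 ^ (n - 1)}"
    using c by auto
  from pigeonhole_card[OF this] obtain i where "card (c -` {i} \<inter> Pow J) * card {1..2 ^ (n - 1) :: nat} \<ge> card (Pow J)"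
    using J by auto
  then have F: "(2::nat) ^ (4 * n) \<le> card (c -` {i} \<inter> Pow J) * 2 ^ (n - 1)"
    using J by (simp add: card_Pow cJ)
  let ?F = "c -` {i} \<inter> Pow J"
  have finF: "finite ?F"
    using J by simp
  have "?F \<noteq> {}"
    using F by (metis card.empty mult_0 le_zero_eq power_eq_0_iff zero_neq_numeral)
  then obtain A where A: "A \<in> ?F"
    by blast
  have "\<exists>B\<in>?F. n < 2 * card (sym_diff A B)"
  proof (rule ccontr)
    assume "\<not> ?thesis"
    then have "sym_diff A ` ?F \<subseteq> {D \<in> Pow J. 2 * card D \<le> n}"
      using A by (auto simp: not_less)
    moreover have "inj_on (sym_diff A) ?F"
      by (rule inj_onI) blast
    ultimately have "card ?F \<le> card {D \<in> Pow J. 2 * card D \<le> n}"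
      using J by (intro card_inj_on_le) auto
    also have "\<dots> \<le> 8 ^ n"
      by (rule card_small_subsets_le[OF J cJ])
    finally have "(2::nat) ^ (4 * n) \<le> 8 ^ n * 2 ^ (n - 1)"
      using F by (meson le_trans mult_le_mono1)
    also have "\<dots> < 8 ^ n * 2 ^ n"
      using n by simp
    also have "\<dots> = (2::nat) ^ (4 * n)"
      by (simp add: power_mult power_mult_distrib[symmetric])
    finally show False by simp
  qed
  then show ?thesis
    using that A by auto
qed

text \<open>
  The test points are normalised indicator functions of subsets of \<open>V ` J\<close>. Two of them that
  share a centre of the covering but differ in more than \<open>n / 2\<close> places force the radius up.
  Coordinates outside \<open>J\<close> can only increase distances.
\<close>
lemma entropy_number_ge_of_large_coordinates:
  fixes p x :: real and w :: "(nat \<Rightarrow> real) \<Rightarrow> nat \<Rightarrow> real" and V :: "nat \<Rightarrow> nat"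
  assumes p: "0 < p" and n: "1 \<le> n" and x: "0 \<le> x"
    and J: "finite J" "card J = 4 * n" "inj_on V J"
    and w: "\<And>z j. j \<in> J \<Longrightarrow> w z j = g j * z (V j)" and g: "\<And>j. j \<in> J \<Longrightarrow> x \<le> \<bar>g j\<bar>"
  shows "ereal (x / 4 * (4 * real n) powr (- 1 / p) * real n powr (1 / 2))
    \<le> entropy_number (ell p) (ell_norm p) (ell 2) (ell_norm 2) w n"
  unfolding entropy_number_def
proof (rule Inf_greatest, clarify)
  fix \<epsilon> :: real and y :: "nat \<Rightarrow> nat \<Rightarrow> real"
  assume \<epsilon>: "0 < \<epsilon>" and y: "\<forall>i\<in>{1..2 ^ (n - 1)}. y i \<in> ell 2"
    and cov: "\<forall>z\<in>ell p. ell_norm p z \<le> 1 \<longrightarrow>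
      w z \<in> ell 2 \<and> (\<exists>i\<in>{1..2 ^ (n - 1)}. ell_norm 2 (w z - y i) \<le> \<epsilon>)"
  define a where "a = (4 * real n) powr (- 1 / p)"
  define Z where "Z B k = (if k \<in> V ` B then a else 0)" for B k
  have a0: "0 \<le> a"
    by (simp add: a_def)
  have Z: "Z B \<in> ell p" "ell_norm p (Z B) \<le> 1" if B: "B \<subseteq> J" for B
  proof -
    have fin: "finite (V ` B)"
      using B J finite_subset by blast
    have 0: "\<bar>Z B k\<bar> powr p = (if k \<in> V ` B then a powr p else 0)" for k
      using p a0 by (simp add: Z_def)
    show "Z B \<in> ell p"
      unfolding ell_def using fin by (auto simp: 0 intro!: summable_finite[of "V ` B"])
    have "(\<Sum>k. \<bar>Z B k\<bar> powr p) = (\<Sum>k\<in>V ` B. \<bar>Z B k\<bar> powr p)"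
      using fin by (intro suminf_finite) (auto simp: 0)
    also have "\<dots> = real (card (V ` B)) * (a powr p)"
      by (simp add: 0)
    also have "\<dots> \<le> real (4 * n) * (a powr p)"
    proof -
      have "card (V ` B) \<le> card J"
        using B J card_image_le[of B V] card_mono[of J B] finite_subset[of B J] by linarith
      then show ?thesis
        using J(2) by (intro mult_right_mono) auto
    qed
    also have "a powr p = 1 / (4 * real n)"
      using p n unfolding a_def by (subst powr_powr) (simp add: powr_minus_divide)
    also have "real (4 * n) * (1 / (4 * real n)) = 1"
      using n by simp
    finally have "(\<Sum>k. \<bar>Z B k\<bar> powr p) \<le> 1" .
    moreover have "0 \<le> (\<Sum>k. \<bar>Z B k\<bar> powr p)"
      by (intro suminf_nonneg summable_finite[OF fin]) (auto simp: 0)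
    ultimately show "ell_norm p (Z B) \<le> 1"
      unfolding ell_norm_def using p by (intro powr_le1) auto
  qed
  have "\<forall>B\<in>Pow J. \<exists>i\<in>{1..2 ^ (n - 1)}. ell_norm 2 (w (Z B) - y i) \<le> \<epsilon>"
    using cov Z by blast
  then obtain c where c: "\<And>B. B \<subseteq> J \<Longrightarrow> c B \<in> {1..2 ^ (n - 1)}"
    "\<And>B. B \<subseteq> J \<Longrightarrow> ell_norm 2 (w (Z B) - y (c B)) \<le> \<epsilon>"
    by (metis PowI)
  obtain A B where AB: "A \<subseteq> J" "B \<subseteq> J" "c A = c B" "n < 2 * card (sym_diff A B)"
    by (rule far_subsets_in_same_class[OF J(1,2) n c(1)], assumption, rule that)
  have dist: "L2_set (w (Z B) - y (c B)) J \<le> \<epsilon>" if B: "B \<subseteq> J" for B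
  proof -
    have "w (Z B) \<in> ell 2" "y (c B) \<in> ell 2"
      using cov Z[OF B] y c(1)[OF B] by auto
    then have s: "summable (\<lambda>k. (w (Z B) k)\<^sup>2)" "summable (\<lambda>k. (y (c B) k)\<^sup>2)"
      by (simp_all add: ell_def)
    have "summable (\<lambda>k. 2 * (w (Z B) k)\<^sup>2 + 2 * (y (c B) k)\<^sup>2)"
      using s by (intro summable_add summable_mult)
    then have "summable (\<lambda>k. (w (Z B) k - y (c B) k)\<^sup>2)"
    proof (rule summable_comparison_test'[where N = 0])
      fix k
      have "(u - v)\<^sup>2 \<le> 2 * u\<^sup>2 + 2 * v\<^sup>2" for u v :: real
        using zero_le_power2[of "u + v"] by (simp add: power2_eq_square algebra_simps)
      then show "norm ((w (Z B) k - y (c B) k)\<^sup>2) \<le> 2 * (w (Z B) k)\<^sup>2 + 2 * (y (c B) k)\<^sup>2"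
        by simp
    qed
    then have "(\<Sum>k\<in>J. (w (Z B) k - y (c B) k)\<^sup>2) \<le> (\<Sum>k. (w (Z B) k - y (c B) k)\<^sup>2)"
      using J by (intro sum_le_suminf) auto
    then have "L2_set (w (Z B) - y (c B)) J \<le> sqrt (\<Sum>k. (w (Z B) k - y (c B) k)\<^sup>2)"
      by (simp add: L2_set_def)
    also have "\<dots> = ell_norm 2 (w (Z B) - y (c B))"
      by (simp add: ell_norm_def powr_half_sqrt suminf_nonneg \<open>summable (\<lambda>k. (w (Z B) k - y (c B) k)\<^sup>2)\<close>)
    also have "\<dots> \<le> \<epsilon>"
      by (rule c(2)[OF B])
    finally show ?thesis .
  qed
  have tri: "L2_set (\<lambda>j. w (Z A) j - w (Z B) j) J \<le> 2 * \<epsilon>"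
  proof -
    have "L2_set (\<lambda>j. w (Z A) j - w (Z B) j) J
        = L2_set (\<lambda>j. (w (Z A) - y (c A)) j + (- (w (Z B) - y (c B))) j) J"
      using AB(3) by simp
    also have "\<dots> \<le> L2_set (w (Z A) - y (c A)) J + L2_set (- (w (Z B) - y (c B))) J"
      by (rule L2_set_triangle_ineq)
    also have "L2_set (- (w (Z B) - y (c B))) J = L2_set (w (Z B) - y (c B)) J"
      by (simp add: L2_set_def power2_commute)
    finally show ?thesis
      using dist[OF AB(1)] dist[OF AB(2)] by linarith
  qed
  have mem: "V j \<in> V ` B \<longleftrightarrow> j \<in> B" if "B \<subseteq> J" "j \<in> J" for B j
    using that J(3) by (meson inj_on_image_mem_iff)
  have D: "sym_diff A B \<subseteq> J"
    using AB by blast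
  have "(x * a)\<^sup>2 * (real n / 2) \<le> (x * a)\<^sup>2 * real (card (sym_diff A B))"
    using AB(4) by (intro mult_left_mono) auto
  also have "\<dots> = (\<Sum>j\<in>sym_diff A B. (x * a)\<^sup>2)"
    by simp
  also have "\<dots> \<le> (\<Sum>j\<in>sym_diff A B. (w (Z A) j - w (Z B) j)\<^sup>2)"
  proof (rule sum_mono)
    fix j assume j: "j \<in> sym_diff A B"
    then have "j \<in> J" using D by blast
    have "\<bar>w (Z A) j - w (Z B) j\<bar> = \<bar>g j\<bar> * a"
      using j a0 mem[OF AB(1) \<open>j \<in> J\<close>] mem[OF AB(2) \<open>j \<in> J\<close>]
      by (auto simp: w[OF \<open>j \<in> J\<close>] Z_def abs_mult)
    then have "x * a \<le> \<bar>w (Z A) j - w (Z B) j\<bar>"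
      using g[OF \<open>j \<in> J\<close>] a0 by (simp add: mult_right_mono)
    then have "(x * a)\<^sup>2 \<le> \<bar>w (Z A) j - w (Z B) j\<bar>\<^sup>2"
      using x a0 by (intro power_mono) auto
    then show "(x * a)\<^sup>2 \<le> (w (Z A) j - w (Z B) j)\<^sup>2"
      by simp
  qed
  also have "\<dots> \<le> (\<Sum>j\<in>J. (w (Z A) j - w (Z B) j)\<^sup>2)"
    using D J by (intro sum_mono2) auto
  also have "\<dots> = (L2_set (\<lambda>j. w (Z A) j - w (Z B) j) J)\<^sup>2"
    by (simp add: L2_set_def sum_nonneg)
  also have "\<dots> \<le> (2 * \<epsilon>)\<^sup>2"
    using tri by (intro power_mono) auto
  finally have "(x * a)\<^sup>2 * (real n / 2) \<le> (2 * \<epsilon>)\<^sup>2" .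
  moreover have "(x * a * (sqrt (real n) / 2))\<^sup>2 \<le> (x * a)\<^sup>2 * (real n / 2)"
    by (simp add: power_mult_distrib power_divide mult_left_mono)
  ultimately have "(x * a * (sqrt (real n) / 2))\<^sup>2 \<le> (2 * \<epsilon>)\<^sup>2"
    by linarith
  then have "x * a * (sqrt (real n) / 2) \<le> 2 * \<epsilon>"
    by (rule power2_le_imp_le) (use \<epsilon> in simp)
  then show "ereal (x / 4 * (4 * real n) powr (- 1 / p) * real n powr (1 / 2)) \<le> ereal \<epsilon>"
    by (simp add: a_def powr_half_sqrt)
qed


section \<open>Number of distinct values and arrival times\<close>

lemma sum_le_sum_initial_segment:
  fixes g :: "nat \<Rightarrow> real"
  assumes "finite A" and g: "antimono g"
  shows "(\<Sum>i\<in>A. g i) \<le> (\<Sum>i<card A. g i)"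
  using assms(1)
proof (induction A rule: finite_linorder_max_induct)
  case (insert b A)
  have "A \<subseteq> {..<b}"
    using insert by auto
  then have "card A \<le> b"
    using card_mono[of "{..<b}" A] by simp
  then have "g b \<le> g (card A)"
    by (rule antimonoD[OF g])
  moreover have "b \<notin> A"
    using insert by auto
  ultimately show ?case
    using insert by simp
qed simp

text \<open>Among all sets of at most \<open>N\<close> points, the initial segment has the largest mass.\<close>
lemma measure_pmf_Compl_ge:
  fixes P :: "nat pmf"
  assumes "antimono (pmf P)" "finite A" "card A \<le> N"
  shows "1 - (\<Sum>i<N. pmf P i) \<le> measure (measure_pmf P) (- A)"
proof -
  have "measure (measure_pmf P) A = (\<Sum>i\<in>A. pmf P i)"
    using assms(2) by (rule measure_measure_pmf_finite)
  also have "\<dots> \<le> (\<Sum>i<card A. pmf P i)"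
    using assms(2,1) by (rule sum_le_sum_initial_segment)
  also have "\<dots> \<le> (\<Sum>i<N. pmf P i)"
    using assms(3) by (intro sum_mono2) auto
  finally show ?thesis
    using measure_pmf.prob_compl[of A P] by (simp add: Compl_eq_Diff_UNIV)
qed

text \<open>
  The event depends on finitely many coordinates with countably many values, so it is a countable
  union of cylinders.
\<close>
lemma sets_few_values:
  fixes N M :: nat and A :: "nat set" and P :: "nat pmf"
  shows "{v. card (A \<union> v ` {..<M}) < N} \<in> sets (Pi\<^sub>M UNIV (\<lambda>_::nat. measure_pmf P))" (is "?X \<in> sets ?S")
proof -
  let ?G = "\<lambda>l. {v \<in> space ?S. \<forall>i<length l. v i = l ! i}"
  let ?L = "{l. length l = M \<and> card (A \<union> set l) < N}"
  have "?G l \<in> sets ?S" for l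
    by measurable
  then have "(\<Union>l\<in>?L. ?G l) \<in> sets ?S"
    by (intro sets.countable_UN'') auto
  also have "(\<Union>l\<in>?L. ?G l) = ?X"
  proof -
    have "v \<in> (\<Union>l\<in>?L. ?G l)" if "v \<in> ?X" for v
      using that by (intro UN_I[of "map v [0..<M]"]) (auto simp: space_PiM atLeast0LessThan)
    moreover have "v \<in> ?X" if "l \<in> ?L" "v \<in> ?G l" for v l
    proof -
      have "v ` {..<M} = set l"
        using that by (auto simp: set_conv_nth image_iff)
      then show ?thesis using that by simp
    qed
    ultimately show ?thesis by blast
  qed
  finally show ?thesis .
qed

text \<open>
  The set \<open>A\<close> contains the values seen before. The quantity behind the bound is the expectation
  of \<open>2 ^ (N - c)\<close>, where \<open>c\<close> is the number of values seen: as long as \<open>c < N\<close>, one more draw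
  halves it with probability at least \<open>\<tau>\<close>, hence multiplies it on average by at most
  \<open>1 - \<tau> / 2\<close>. The induction splits off the first draw and enlarges \<open>A\<close> by its value.
\<close>
lemma emeasure_few_values_le:
  fixes P :: "nat pmf" and A :: "nat set" and N M :: nat
  assumes anti: "antimono (pmf P)" and A: "finite A"
  defines "\<tau> \<equiv> 1 - (\<Sum>i<N. pmf P i)"
  shows "emeasure (Pi\<^sub>M UNIV (\<lambda>_::nat. measure_pmf P)) {v. card (A \<union> v ` {..<M}) < N}
    \<le> ennreal (2 ^ N / 2 ^ card A * (1 - \<tau> / 2) ^ M)"
  using A
proof (induction M arbitrary: A)
  interpret sequence_space "measure_pmf P" ..
  have \<tau>: "\<tau> \<le> 1"
    by (simp add: \<tau>_def sum_nonneg)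
  {
    case (0 A)
    show ?case
    proof (cases "card A < N")
      case True
      then have "(2::real) ^ card A \<le> 2 ^ N"
        by (intro power_increasing) auto
      then have "1 \<le> ennreal (2 ^ N / 2 ^ card A)"
        by simp
      then show ?thesis
        using True P.emeasure_space_1 by (simp add: space_PiM)
    qed simp
  next
    case (Suc M A)
    show ?case
    proof (cases "card A < N")
      case False
      have "card A \<le> card (A \<union> v ` {..<Suc M})" for v
        using Suc.prems by (intro card_mono) auto
      then have "{v. card (A \<union> v ` {..<Suc M}) < N} = {}"
        using False by (auto simp: not_less intro: le_trans)
      then show ?thesis by simp
    next
      case True
      let ?X = "{v. card (A \<union> v ` {..<Suc M}) < N}"
      let ?c = "2 ^ N / 2 ^ card A * (1 - \<tau> / 2) ^ M :: real"
      have c: "0 \<le> ?c"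
        using \<tau> by simp
      have img: "case_nat s v ` {..<Suc M} = insert s (v ` {..<M})" for s v
        by (simp add: lessThan_Suc_eq_insert_0 image_image)
      have "emeasure S ?X = (\<integral>\<^sup>+v. indicator ?X v \<partial>S)"
        using sets_few_values by simp
      also have "\<dots> = (\<integral>\<^sup>+x. indicator ?X (case x of (s, v) \<Rightarrow> case_nat s v) \<partial>(measure_pmf P \<Otimes>\<^sub>M S))"
        using sets_few_values[of A "Suc M" N P] by (subst PiM_iter[symmetric]) (subst nn_integral_distr, auto)
      also have "\<dots> = (\<integral>\<^sup>+s. \<integral>\<^sup>+v. indicator ?X (case_nat s v) \<partial>S \<partial>measure_pmf P)"
        using sets_few_values[of A "Suc M" N P]
        by (subst P.nn_integral_fst[symmetric]) (auto intro!: measurable_compose[OF _ borel_measurable_indicator])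
      also have "\<dots> = (\<integral>\<^sup>+s. emeasure S {v. card (insert s A \<union> v ` {..<M}) < N} \<partial>measure_pmf P)"
      proof (intro nn_integral_cong)
        fix s
        have "(\<lambda>v. indicator ?X (case_nat s v)) = (indicator {v. card (insert s A \<union> v ` {..<M}) < N} :: _ \<Rightarrow> ennreal)"
          unfolding indicator_def by (simp add: img)
        then show "(\<integral>\<^sup>+v. indicator ?X (case_nat s v) \<partial>S) = emeasure S {v. card (insert s A \<union> v ` {..<M}) < N}"
          using sets_few_values[of "insert s A" M N P] by simp
      qed
      also have "\<dots> \<le> (\<integral>\<^sup>+s. ennreal (?c * (1 - indicator (- A) s / 2)) \<partial>measure_pmf P)"
      proof (intro nn_integral_mono)
        fix s
        have "emeasure S {v. card (insert s A \<union> v ` {..<M}) < N}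
            \<le> ennreal (2 ^ N / 2 ^ card (insert s A) * (1 - \<tau> / 2) ^ M)"
          using Suc.prems by (intro Suc.IH) simp
        also have "2 ^ N / 2 ^ card (insert s A) * (1 - \<tau> / 2) ^ M = ?c * (1 - indicator (- A) s / 2)"
          using Suc.prems by (simp add: card_insert_if indicator_def)
        finally show "emeasure S {v. card (insert s A \<union> v ` {..<M}) < N} \<le> ennreal (?c * (1 - indicator (- A) s / 2))" .
      qed
      also have "\<dots> = ennreal (\<integral>s. ?c * (1 - indicator (- A) s / 2) \<partial>measure_pmf P)"
      proof (rule nn_integral_eq_integral)
        show "integrable (measure_pmf P) (\<lambda>s. ?c * (1 - indicator (- A) s / 2))"
          by (intro measure_pmf.integrable_const_bound[where B = ?c]) (use c in \<open>auto simp: indicator_def\<close>)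
      qed (use c in \<open>auto simp: indicator_def\<close>)
      also have "(\<integral>s. ?c * (1 - indicator (- A) s / 2) \<partial>measure_pmf P) = ?c * (1 - measure (measure_pmf P) (- A) / 2)"
      proof -
        have "integrable (measure_pmf P) (indicator (- A) :: nat \<Rightarrow> real)"
          by (intro measure_pmf.integrable_const_bound[where B = 1]) auto
        then show ?thesis by simp
      qed
      also have "\<dots> \<le> ?c * (1 - \<tau> / 2)"
        using measure_pmf_Compl_ge[OF anti Suc.prems, of N] True c
        by (intro mult_left_mono) (auto simp: \<tau>_def)
      also have "?c * (1 - \<tau> / 2) = 2 ^ N / 2 ^ card A * (1 - \<tau> / 2) ^ Suc M"
        by simp
      finally show ?thesis
        by (simp only: ennreal_leI)
    qed
  }
qed

text \<open>
  The failure probability is at most \<open>2 ^ N * exp (- 2 * N) \<le> 2 ^ (- N)\<close>, which is summable, so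
  the Borel--Cantelli lemma applies.
\<close>
lemma AE_many_values:
  fixes P :: "nat pmf" and N M :: "nat \<Rightarrow> nat"
  assumes anti: "antimono (pmf P)" and N: "\<And>n. n \<le> N n"
    and M: "\<And>n. 4 * real (N n) \<le> real (M n) * (1 - (\<Sum>i<N n. pmf P i))"
  shows "AE v in Pi\<^sub>M UNIV (\<lambda>_::nat. measure_pmf P). \<forall>\<^sub>F n in sequentially. N n \<le> card (v ` {..<M n})"
proof -
  interpret sequence_space "measure_pmf P" ..
  let ?X = "\<lambda>n. {v. card ({} \<union> v ` {..<M n}) < N n}"
  have bound: "emeasure S (?X n) \<le> ennreal ((1 / 2) ^ n)" for n
  proof -
    define \<tau> where "\<tau> = 1 - (\<Sum>i<N n. pmf P i)"
    have \<tau>: "\<tau> \<le> 1"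
      by (simp add: \<tau>_def sum_nonneg)
    have "emeasure S (?X n) \<le> ennreal (2 ^ N n / 2 ^ card ({} :: nat set) * (1 - \<tau> / 2) ^ M n)"
      unfolding \<tau>_def by (rule emeasure_few_values_le[OF anti]) simp
    also have "\<dots> \<le> ennreal ((1 / 2) ^ n)"
    proof (rule ennreal_leI)
      have "(1 - \<tau> / 2) ^ M n \<le> exp (- (\<tau> / 2)) ^ M n"
        using \<tau> exp_ge_add_one_self[of "- (\<tau> / 2)"] by (intro power_mono) auto
      also have "\<dots> = exp (- (real (M n) * \<tau> / 2))"
        by (simp add: exp_of_nat_mult[symmetric])
      also have "\<dots> \<le> exp (real (N n) * (- 2))"
        using M[of n] by (simp add: \<tau>_def)
      also have "\<dots> = exp (- 2) ^ N n"
        by (rule exp_of_nat_mult)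
      also have "\<dots> \<le> (1 / 4) ^ N n"
      proof (rule power_mono)
        have "2 ^ 2 \<le> exp (1 :: real) ^ 2"
          using exp_ge_add_one_self[of 1] by (intro power_mono) auto
        also have "\<dots> = exp (2 :: real)"
          by (simp add: exp_of_nat_mult[symmetric])
        finally show "exp (- 2) \<le> (1 / 4 :: real)"
          by (simp add: exp_minus field_simps)
      qed simp
      finally have "2 ^ N n / 2 ^ card ({} :: nat set) * (1 - \<tau> / 2) ^ M n \<le> 2 ^ N n * (1 / 4) ^ N n"
        by simp
      also have "\<dots> = (1 / 2 :: real) ^ N n"
        by (simp add: power_mult_distrib[symmetric])
      also have "\<dots> \<le> (1 / 2) ^ n"
        using N[of n] by (intro power_decreasing) auto
      finally show "2 ^ N n / 2 ^ card ({} :: nat set) * (1 - \<tau> / 2) ^ M n \<le> (1 / 2 :: real) ^ n" .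
    qed
    finally show ?thesis .
  qed
  have "AE v in S. \<forall>\<^sub>F n in sequentially. v \<in> space S - ?X n"
  proof (rule borel_cantelli_AE1)
    show "?X n \<in> sets S" for n
      by (rule sets_few_values)
    show "emeasure S (?X n) < \<infinity>" for n
      using bound[of n] by (rule le_less_trans) simp
    have "measure S (?X n) \<le> (1 / 2) ^ n" for n
      using bound[of n] unfolding measure_def by (intro enn2real_leI) simp_all
    then show "summable (\<lambda>n. measure S (?X n))"
      by (intro summable_comparison_test'[OF summable_geometric[of "1 / 2"], where N = 0]) auto
  qed
  then show ?thesis
    by eventually_elim (auto simp: not_less elim: eventually_mono)
qed

lemma nn_integral_exp_half_exponential:
  "(\<integral>\<^sup>+x. ennreal (exponential_density 1 x) * ennreal (exp (x / 2)) \<partial>lborel) = 2"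
proof -
  have "ennreal (exponential_density 1 x) * ennreal (exp (x / 2)) = 2 * ennreal (exponential_density (1 / 2) x)" for x
    by (simp add: exponential_density_def ennreal_mult[symmetric] exp_add[symmetric]
        ennreal_numeral[symmetric] del: ennreal_numeral)
  then have "(\<integral>\<^sup>+x. ennreal (exponential_density 1 x) * ennreal (exp (x / 2)) \<partial>lborel)
      = 2 * (\<integral>\<^sup>+x. ennreal (exponential_density (1 / 2) x) \<partial>lborel)"
    by (simp add: nn_integral_cmult)
  also have "(\<integral>\<^sup>+x. ennreal (exponential_density (1 / 2) x) \<partial>lborel) = 1"
    using prob_space.emeasure_space_1[OF prob_space_exponential_density[of "1 / 2"]]
    by (simp add: emeasure_density)
  finally show ?thesis by simp
qed

text \<open>
  Chernoff's bound at parameter 1/2, where the exponential law has the moment 2: the sum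
  exceeds \<open>4 * n\<close> with probability at most \<open>(2 * exp (- 2)) ^ n\<close>.
\<close>
lemma (in prob_space) AE_sum_exponential_le:
  fixes \<zeta> :: "nat \<Rightarrow> 'a \<Rightarrow> real"
  assumes ind: "indep_vars (\<lambda>_. borel) \<zeta> UNIV"
    and dist: "\<And>j. distributed M lborel (\<zeta> j) (\<lambda>x. ennreal (exponential_density 1 x))"
  shows "AE \<omega> in M. \<forall>\<^sub>F n in sequentially. (\<Sum>i<n. \<zeta> i \<omega>) \<le> 4 * real n"
proof -
  have [measurable]: "\<zeta> j \<in> borel_measurable M" for j
    using ind by (simp add: indep_vars_def)
  let ?X = "\<lambda>n. {\<omega> \<in> space M. 4 * real n < (\<Sum>i<n. \<zeta> i \<omega>)}"
  have bound: "emeasure M (?X n) \<le> ennreal ((1 / 2) ^ n)" for n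
  proof -
    have "emeasure M (?X n) \<le> emeasure M {\<omega> \<in> space M. 1 \<le> ennreal (exp (- 2) ^ n) * (\<Prod>i<n. ennreal (exp (\<zeta> i \<omega> / 2)))}"
    proof (intro emeasure_mono subsetI)
      fix \<omega> assume \<omega>: "\<omega> \<in> ?X n"
      have "ennreal (exp (- 2) ^ n) * (\<Prod>i<n. ennreal (exp (\<zeta> i \<omega> / 2))) = ennreal (exp (- 2 * real n + (\<Sum>i<n. \<zeta> i \<omega>) / 2))"
        by (simp add: prod_ennreal exp_sum[symmetric] sum_divide_distrib exp_of_nat_mult[symmetric]
            exp_add[symmetric] ennreal_mult[symmetric] mult.commute)
      also have "1 \<le> \<dots>"
        using \<omega> by (simp add: ennreal_ge_1)
      finally show "\<omega> \<in> {\<omega> \<in> space M. 1 \<le> ennreal (exp (- 2) ^ n) * (\<Prod>i<n. ennreal (exp (\<zeta> i \<omega> / 2)))}"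
        using \<omega> by simp
    qed simp
    also have "\<dots> \<le> ennreal (exp (- 2) ^ n) * (\<integral>\<^sup>+\<omega>. (\<Prod>i<n. ennreal (exp (\<zeta> i \<omega> / 2))) \<partial>M)"
      using nn_integral_Markov_inequality[of "\<lambda>\<omega>. \<Prod>i<n. ennreal (exp (\<zeta> i \<omega> / 2))" "space M" M "ennreal (exp (- 2) ^ n)"]
      by (simp cong: nn_integral_cong)
    also have "(\<integral>\<^sup>+\<omega>. (\<Prod>i<n. ennreal (exp (\<zeta> i \<omega> / 2))) \<partial>M) = (\<Prod>i<n. \<integral>\<^sup>+\<omega>. ennreal (exp (\<zeta> i \<omega> / 2)) \<partial>M)"
    proof (rule indep_vars_nn_integral)
      show "indep_vars (\<lambda>_. borel) (\<lambda>i \<omega>. ennreal (exp (\<zeta> i \<omega> / 2))) {..<n}"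
        using indep_vars_compose2[OF indep_vars_subset[OF ind, of "{..<n}"], of "\<lambda>_ x. ennreal (exp (x / 2))" "\<lambda>_. borel"]
        by simp
    qed auto
    also have "(\<Prod>i<n. \<integral>\<^sup>+\<omega>. ennreal (exp (\<zeta> i \<omega> / 2)) \<partial>M) = 2 ^ n"
      using distributed_nn_integral[OF dist, of "\<lambda>x. ennreal (exp (x / 2))"]
      by (simp add: nn_integral_exp_half_exponential)
    also have "ennreal (exp (- 2) ^ n) * 2 ^ n = ennreal ((exp (- 2) * 2) ^ n)"
      by (simp add: power_mult_distrib ennreal_mult ennreal_power[symmetric])
    also have "\<dots> \<le> ennreal ((1 / 2) ^ n)"
    proof (intro ennreal_leI power_mono)
      have "2 ^ 2 \<le> exp (1 :: real) ^ 2"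
        using exp_ge_add_one_self[of 1] by (intro power_mono) auto
      also have "\<dots> = exp (2 :: real)"
        by (simp add: exp_of_nat_mult[symmetric])
      finally show "exp (- 2) * 2 \<le> (1 / 2 :: real)"
        by (simp add: exp_minus field_simps)
    qed simp
    finally show ?thesis .
  qed
  have "AE \<omega> in M. \<forall>\<^sub>F n in sequentially. \<omega> \<in> space M - ?X n"
  proof (rule borel_cantelli_AE1)
    show "?X n \<in> events" for n
      by measurable
    show "emeasure M (?X n) < \<infinity>" for n
      using bound[of n] by (rule le_less_trans) simp
    have "prob (?X n) \<le> (1 / 2) ^ n" for n
      using bound[of n] unfolding measure_def by (intro enn2real_leI) simp_all
    then show "summable (\<lambda>n. prob (?X n))"
      by (intro summable_comparison_test'[OF summable_geometric[of "1 / 2"], where N = 0]) auto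
  qed
  then show ?thesis
    by eventually_elim (auto simp: not_less elim: eventually_mono)
qed

lemma (in prob_space) AE_exponential_pos:
  assumes "distributed M lborel X (\<lambda>x. ennreal (exponential_density 1 x))"
  shows "AE \<omega> in M. 0 < X \<omega>"
proof (subst distributed_AE2[OF assms])
  show "AE x in lborel. 0 < ennreal (exponential_density 1 x) \<longrightarrow> 0 < x"
    using AE_lborel_singleton[of "0::real"]
    by eventually_elim (auto simp: exponential_density_def split: if_splits)
qed simp

lemma random_model_AE_fst:
  fixes P :: "nat pmf"
  assumes "random_model (measure_pmf P) Q V \<zeta>"
    and "AE v in Pi\<^sub>M UNIV (\<lambda>_::nat. measure_pmf P). R v"
  shows "AE \<omega> in Q. R (\<lambda>j. V j \<omega>)"
proof -
  let ?D = "density lborel (\<lambda>x. ennreal (exponential_density 1 x))"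
  interpret D: prob_space ?D
    by (rule prob_space_exponential_density) simp
  have T: "prob_space (Pi\<^sub>M UNIV (\<lambda>_::nat. ?D))"
    by (intro prob_space_PiM D.prob_space_axioms)
  have "uniform_measure (measure_pmf P) (space (measure_pmf P)) = measure_pmf P"
    by (rule measure_eqI) (simp_all add: emeasure_uniform_measure divide_ennreal_def)
  then have law: "model_law (measure_pmf P) = Pi\<^sub>M UNIV (\<lambda>_. measure_pmf P) \<Otimes>\<^sub>M Pi\<^sub>M UNIV (\<lambda>_. ?D)"
    by (simp add: model_law_def)
  let ?S = "Pi\<^sub>M UNIV (\<lambda>_::nat. measure_pmf P)" and ?T = "Pi\<^sub>M UNIV (\<lambda>_::nat. ?D)"
  have eq: "distr (?S \<Otimes>\<^sub>M ?T) ?S fst = ?S"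
    by (rule prob_space.distr_pair_fst[OF T])
  have "AE v in distr (?S \<Otimes>\<^sub>M ?T) ?S fst. R v"
    unfolding eq by (rule assms(2))
  from AE_distrD[OF measurable_fst this] have "AE y in model_law (measure_pmf P). R (fst y)"
    unfolding law .
  then show ?thesis
    using random_model_AE[OF assms(1), of "\<lambda>v x. R v"] by (simp add: case_prod_beta)
qed


section \<open>A probability measure with prescribed hazard rate\<close>

text \<open>
  The survival function of an integer-valued random variable whose mass at \<open>k\<close> is \<open>b k\<close> times the
  probability of exceeding \<open>k\<close>. Prescribing this ratio makes the ratio of tail and mass, which
  governs the entropy gap, exactly \<open>1 / b k\<close>.
\<close>
definition survival :: "(nat \<Rightarrow> real) \<Rightarrow> nat \<Rightarrow> real"
  where "survival b k = (\<Prod>j\<in>{1..k}. 1 / (1 + b j))"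

lemma survival_0 [simp]: "survival b 0 = 1"
  by (simp add: survival_def)

lemma survival_Suc: "survival b (Suc k) = survival b k / (1 + b (Suc k))"
  by (simp add: survival_def)

locale hazard_rate =
  fixes b :: "nat \<Rightarrow> real" and R :: real
  assumes b_pos: "1 \<le> k \<Longrightarrow> 0 < b k"
    and b_decreasing: "1 \<le> j \<Longrightarrow> j \<le> k \<Longrightarrow> real k * b k \<le> real j * b j"
    and b_doubling: "1 \<le> k \<Longrightarrow> b k \<le> R * b (2 * k)"
begin

lemma survival_pos: "0 < survival b k"
  by (induction k) (auto simp: survival_Suc b_pos add_pos_pos)

lemma survival_antimono: "j \<le> k \<Longrightarrow> survival b k \<le> survival b j"
proof (induction k rule: dec_induct)
  case (step k)
  have "survival b k / (1 + b (Suc k)) \<le> survival b k / 1"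
    using survival_pos[of k] b_pos[of "Suc k"] by (intro divide_left_mono) auto
  with step show ?case by (simp add: survival_Suc)
qed simp

lemma survival_le_one: "survival b k \<le> 1"
  using survival_antimono[of 0 k] by simp

lemma survival_diff: "survival b k - survival b (Suc k) = b (Suc k) * survival b (Suc k)"
  using b_pos[of "Suc k"] by (simp add: survival_Suc field_simps)

text \<open>
  Between \<open>k\<close> and \<open>2 * k\<close> each of the \<open>k\<close> factors is at most \<open>exp (b 1 / k)\<close>, since
  \<open>j * b j \<le> b 1\<close>.
\<close>
lemma survival_doubling:
  assumes k: "1 \<le> k"
  shows "survival b k \<le> exp (b 1) * survival b (2 * k)"
proof -
  have "survival b k \<le> exp (real i * (b 1 / real k)) * survival b (k + i)" for i
  proof (induction i)
    case (Suc i)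
    have "real k * b (Suc (k + i)) \<le> real (Suc (k + i)) * b (Suc (k + i))"
      using b_pos[of "Suc (k + i)"] by (intro mult_right_mono) auto
    also have "\<dots> \<le> b 1"
      using b_decreasing[of 1 "Suc (k + i)"] by simp
    finally have "b (Suc (k + i)) \<le> b 1 / real k"
      using k by (simp add: field_simps)
    then have "1 + b (Suc (k + i)) \<le> exp (b 1 / real k)"
      using exp_ge_add_one_self[of "b 1 / real k"] by linarith
    then have "survival b (Suc (k + i)) * (1 + b (Suc (k + i))) \<le> survival b (Suc (k + i)) * exp (b 1 / real k)"
      using survival_pos by (intro mult_left_mono) (auto simp: less_imp_le)
    moreover have "survival b (Suc (k + i)) * (1 + b (Suc (k + i))) = survival b (k + i)"
      using b_pos[of "Suc (k + i)"] by (simp add: survival_Suc)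
    ultimately have "exp (real i * (b 1 / real k)) * survival b (k + i)
        \<le> exp (real i * (b 1 / real k)) * (survival b (Suc (k + i)) * exp (b 1 / real k))"
      by (intro mult_left_mono) auto
    also have "\<dots> = exp (real (Suc i) * (b 1 / real k)) * survival b (k + Suc i)"
      by (simp add: exp_add[symmetric] algebra_simps add_divide_distrib)
    finally show ?case using Suc by linarith
  qed simp
  from this[of k] show ?thesis
    using k by (simp add: mult_2)
qed

lemma regular_weight_survival:
  shows "regular_weight (\<lambda>k. b k * survival b k) (R * exp (b 1))"
proof
  fix k :: nat assume k: "1 \<le> k"
  show "0 < b k * survival b k"
    using b_pos[OF k] survival_pos by simp
  have "b k * survival b k \<le> (R * b (2 * k)) * (exp (b 1) * survival b (2 * k))"
    using b_doubling[OF k] survival_doubling[OF k] b_pos[OF k] survival_pos[of k]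
    by (intro mult_mono) auto
  then show "b k * survival b k \<le> R * exp (b 1) * (b (2 * k) * survival b (2 * k))"
    by (simp add: ac_simps)
next
  fix j k :: nat assume "1 \<le> j" "j \<le> k"
  then have "(real k * b k) * survival b k \<le> (real j * b j) * survival b j"
    using b_pos[of j] survival_pos[of k]
    by (intro mult_mono b_decreasing survival_antimono mult_nonneg_nonneg) (auto simp: less_imp_le)
  then show "real k * (b k * survival b k) \<le> real j * (b j * survival b j)"
    by (simp add: mult.assoc)
qed

lemma sum_survival: "(\<Sum>i<n. b (Suc i) * survival b (Suc i)) = 1 - survival b n"
  by (induction n) (simp_all add: survival_diff[symmetric])

text \<open>
  The reciprocal of \<open>survival b n\<close>, a product of factors \<open>1 + b j\<close>, is at least the sum of the
  \<open>b j\<close>.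
\<close>
lemma survival_tendsto_0:
  assumes "(\<Sum>k. ennreal (b (Suc k))) = \<infinity>"
  shows "survival b \<longlonglongrightarrow> 0"
proof -
  have sum_le: "(\<Sum>i<n. b (Suc i)) \<le> 1 / survival b n" for n
  proof -
    have "1 + (\<Sum>i<n. b (Suc i)) \<le> 1 / survival b n"
    proof (induction n)
      case (Suc n)
      have "b (Suc n) \<le> b (Suc n) / survival b n"
        using survival_pos[of n] survival_le_one[of n] b_pos[of "Suc n"] by (simp add: field_simps)
      then show ?case
        using Suc by (simp add: survival_Suc add_divide_distrib)
    qed simp
    then show ?thesis by simp
  qed
  show ?thesis
  proof (rule LIMSEQ_I)
    fix r :: real assume r: "0 < r"
    obtain n where n: "1 / r < (\<Sum>i<n. b (Suc i))"
    proof (rule ccontr)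
      assume "\<not> thesis"
      then have le: "(\<Sum>i<n. b (Suc i)) \<le> 1 / r" for n
        using that by (meson not_less)
      have "(\<Sum>k. ennreal (b (Suc k))) \<le> ennreal (1 / r)"
      proof (rule suminf_le_const[OF summableI])
        show "(\<Sum>i<n. ennreal (b (Suc i))) \<le> ennreal (1 / r)" for n
          using le[of n] b_pos by (subst sum_ennreal) (auto intro: ennreal_leI less_imp_le)
      qed
      with assms show False by (simp add: top_unique)
    qed
    then have "1 / r < 1 / survival b n"
      using sum_le[of n] by linarith
    then have "survival b n < r"
      using r survival_pos[of n] by (simp add: field_simps)
    then have "norm (survival b k - 0) < r" if "n \<le> k" for k
      using survival_antimono[OF that] survival_pos[of k] by simp
    then show "\<exists>n. \<forall>k\<ge>n. norm (survival b k - 0) < r"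
      by blast
  qed
qed

text \<open>The masses telescope, and the limit 0 of the survival function makes the total mass 1.\<close>
lemma survival_pmf:
  assumes "(\<Sum>k. ennreal (b (Suc k))) = \<infinity>"
  obtains P :: "nat pmf" where "\<And>i. pmf P i = b (Suc i) * survival b (Suc i)"
proof
  let ?s = "\<lambda>i. b (Suc i) * survival b (Suc i)"
  have nonneg: "0 \<le> ?s i" for i
    using b_pos[of "Suc i"] survival_pos[of "Suc i"] by simp
  have "(\<lambda>n. 1 - survival b n) \<longlonglongrightarrow> 1 - 0"
    by (intro tendsto_intros survival_tendsto_0[OF assms])
  then have "?s sums 1"
    by (simp add: sums_def sum_survival)
  then have "(\<integral>\<^sup>+i. ennreal (?s i) \<partial>count_space UNIV) = 1"
    using suminf_ennreal_eq[OF nonneg] by (simp add: nn_integral_count_space_nat)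
  then show "pmf (embed_pmf ?s) i = ?s i" for i
    using nonneg by (simp add: pmf_embed_pmf)
qed

end


section \<open>The entropy gap\<close>

text \<open>
  The bounds are real, while the extended quotient covers a vanishing denominator and an infinite
  numerator, neither of which a bound from one side excludes for entropy numbers.
\<close>
lemma ereal_divide_ge:
  fixes a c :: ereal
  assumes "ereal A \<le> a" "0 < A" "0 \<le> c" "c \<le> ereal B" "0 < B"
  shows "ereal (A / B) \<le> a / c"
proof (cases "c = 0")
  case True
  have "0 < a"
    using assms(1,2) by (metis ereal_less(2) less_le_trans)
  with True show ?thesis
    by (cases a) (auto simp: divide_ereal_def)
next
  case False
  then obtain r where r: "c = ereal r" "0 < r" "r \<le> B"
    using assms by (cases c) auto
  show ?thesis
  proof (cases a)
    case (real x)
    then have "A / B \<le> x / r"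
      using assms r by (intro frac_le) auto
    with real r show ?thesis by simp
  qed (use assms r in auto)
qed

lemma preceqI:
  assumes "0 < q" "\<forall>\<^sub>F n in sequentially. 0 < d n \<and> ereal (q * d n) \<le> G n"
  shows "(\<lambda>n. ereal (d n)) \<preceq> G"
proof -
  have "\<forall>\<^sub>F n in sequentially. ereal (d n) / G n \<le> ereal (1 / q)"
    using assms(2)
  proof eventually_elim
    case (elim n)
    show ?case
    proof (cases "G n")
      case (real g)
      then have le: "q * d n \<le> g"
        using elim by simp
      moreover have "0 < q * d n"
        using elim assms(1) by simp
      ultimately have "d n / g \<le> 1 / q" and "0 < g"
        using assms(1) by (simp_all add: field_simps)
      with real show ?thesis by simp
    qed (use elim assms(1) in auto)
  qed
  then have "limsup (\<lambda>n. ereal (d n) / G n) \<le> ereal (1 / q)"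
    by (rule Limsup_bounded)
  then show ?thesis
    unfolding preceq_def by (rule le_less_trans) simp
qed

text \<open>
  The limit superior controls all large \<open>k\<close>; for the finitely many others, monotonicity compares
  with \<open>d 1\<close>.
\<close>
lemma mono_doublingE:
  fixes d :: "nat \<Rightarrow> real"
  assumes pos: "\<And>k. 1 \<le> k \<Longrightarrow> 0 < d k" and mono: "mono_on {1..} d"
    and dbl: "(\<lambda>n. ereal (d (2 * n))) \<preceq> (\<lambda>n. ereal (d n))"
  obtains K where "0 < K" "\<And>k. 1 \<le> k \<Longrightarrow> d (2 * k) \<le> K * d k"
proof -
  obtain L where L: "limsup (\<lambda>n. ereal (d (2 * n)) / ereal (d n)) < ereal L"
    using dbl unfolding preceq_def by (meson ereal_dense2)
  from Limsup_lessD[OF L] obtain n0 where n0: "\<And>n. n0 \<le> n \<Longrightarrow> ereal (d (2 * n)) / ereal (d n) < ereal L"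
    by (auto simp: eventually_sequentially)
  define K where "K = max L (d (2 * Suc n0) / d 1)"
  have K: "0 < K"
    using pos[of 1] pos[of "2 * Suc n0"] by (simp add: K_def less_max_iff_disj)
  have "d (2 * k) \<le> K * d k" if k: "1 \<le> k" for k
  proof (cases "n0 \<le> k")
    case True
    have "d (2 * k) / d k < L"
      using n0[OF True] pos[OF k] by simp
    then have "d (2 * k) \<le> L * d k"
      using pos[OF k] by (simp add: field_simps)
    also have "\<dots> \<le> K * d k"
      using pos[OF k] by (intro mult_right_mono) (auto simp: K_def)
    finally show ?thesis .
  next
    case False
    have "d (2 * k) \<le> d (2 * Suc n0)"
      using k False by (intro mono_onD[OF mono]) auto
    also have "\<dots> = d (2 * Suc n0) / d 1 * d 1"
      using pos[of 1] by simp
    also have "\<dots> \<le> K * d k"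
      using k K pos[of 1] by (intro mult_mono mono_onD[OF mono]) (auto simp: K_def)
    finally show ?thesis .
  qed
  with K show ?thesis by (rule that)
qed

lemma entropy_number_nonneg: "0 \<le> entropy_number E normE F normF w n"
  unfolding entropy_number_def by (intro Inf_greatest) (auto intro: less_imp_le)

text \<open>
  For each of \<open>4 * n\<close> different values pick one draw that attains it. On these coordinates the
  operator multiplies distinct entries of its argument by at least
  \<open>c_stable \<alpha> * (4 * M) powr (- 1 / \<alpha>)\<close>.
\<close>
lemma random_operator_entropy_ge:
  fixes V :: "nat \<Rightarrow> 'w \<Rightarrow> nat" and \<sigma> :: "nat measure"
  assumes \<sigma>: "prob_space \<sigma>" and \<alpha>: "0 < \<alpha>" "\<alpha> < 2" and p: "0 < p" and n: "1 \<le> n"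
    and distinct: "4 * n \<le> card ((\<lambda>j. V j \<omega>) ` {..<M})"
    and \<zeta>: "\<And>j. 0 < \<zeta> j \<omega>" "(\<Sum>i<M. \<zeta> i \<omega>) \<le> 4 * real M"
  shows "ereal (c_stable \<alpha> * (4 * real M) powr (- 1 / \<alpha>) / 4 * (4 * real n) powr (- 1 / p) * real n powr (1 / 2))
    \<le> entropy_number (ell p) (ell_norm p) (ell 2) (ell_norm 2) (random_operator \<alpha> \<sigma> embedding V \<zeta> \<omega>) n"
proof -
  obtain S where S: "S \<subseteq> (\<lambda>j. V j \<omega>) ` {..<M}" "card S = 4 * n"
    using obtain_subset_with_card_n[OF distinct] by blast
  then obtain J where J: "J \<subseteq> {..<M}" "inj_on (\<lambda>j. V j \<omega>) J" "S = (\<lambda>j. V j \<omega>) ` J"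
    by (auto simp: subset_image_inj)
  have fin: "finite J"
    using J(1) finite_subset by blast
  have arr: "0 < arrival \<zeta> j \<omega>" "arrival \<zeta> j \<omega> \<le> 4 * real M" if "j \<in> J" for j
  proof -
    show "0 < arrival \<zeta> j \<omega>"
      unfolding arrival_def using \<zeta>(1) by (intro sum_pos) auto
    have "arrival \<zeta> j \<omega> \<le> (\<Sum>i<M. \<zeta> i \<omega>)"
      unfolding arrival_def using that J(1) \<zeta>(1) by (intro sum_mono2) (auto simp: less_imp_le)
    with \<zeta>(2) show "arrival \<zeta> j \<omega> \<le> 4 * real M" by linarith
  qed
  show ?thesis
  proof (rule entropy_number_ge_of_large_coordinates[where J = J and V = "\<lambda>j. V j \<omega>"
        and g = "\<lambda>j. c_stable \<alpha> * arrival \<zeta> j \<omega> powr (- 1 / \<alpha>)"])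
    show "card J = 4 * n"
      using S(2) J(2,3) by (simp add: card_image)
    show "random_operator \<alpha> \<sigma> embedding V \<zeta> \<omega> z j = c_stable \<alpha> * arrival \<zeta> j \<omega> powr (- 1 / \<alpha>) * z (V j \<omega>)" for z j
      using prob_space.prob_space[OF \<sigma>] by (simp add: random_operator_def embedding_def)
    show "c_stable \<alpha> * (4 * real M) powr (- 1 / \<alpha>) \<le> \<bar>c_stable \<alpha> * arrival \<zeta> j \<omega> powr (- 1 / \<alpha>)\<bar>" if "j \<in> J" for j
      using arr[OF that] c_stable_pos[OF \<alpha>] \<alpha> by (simp add: abs_mult powr_mono2')
    show "0 \<le> c_stable \<alpha> * (4 * real M) powr (- 1 / \<alpha>)"
      using c_stable_pos[OF \<alpha>] by simp
  qed (use fin J p n in auto)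
qed

theorem proposition6p4:
  fixes \<alpha> p :: real and d :: "nat \<Rightarrow> real"
  assumes "0 < \<alpha>" and "\<alpha> < 2"
    and "\<And>k. k \<ge> 1 \<Longrightarrow> d k > 0"
    and "mono_on {1..} d"
    and "same_order (\<lambda>n. ereal (d n)) (\<lambda>n. ereal (d (2 * n)))"
    and "(\<Sum>k. ennreal (d (Suc k) powr (- \<alpha>) / real (Suc k))) = \<infinity>"
    and "(\<lambda>k. ereal (ln (real k) powr (1 / (2 * \<alpha>)))) \<preceq> (\<lambda>k. ereal (d k))"
    and "1 \<le> p"
  shows "\<exists>\<sigma> :: nat measure. prob_space \<sigma> \<and> sets \<sigma> = UNIV \<and>
    (\<forall>(Q :: 'w measure) V \<zeta>. random_model \<sigma> Q V \<zeta> \<longrightarrow>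
       (AE \<omega> in Q. (\<lambda>n. ereal (d n)) \<preceq>
          (\<lambda>n. entropy_gap \<alpha> (ell p) (ell_norm p) \<sigma> embedding V \<zeta> n \<omega>)))"
proof -
  note \<alpha> = assms(1,2) and d_pos = assms(3) and d_mono = assms(4) and p = assms(8)
  obtain K where K: "0 < K" "\<And>k. 1 \<le> k \<Longrightarrow> d (2 * k) \<le> K * d k"
    using mono_doublingE[OF d_pos d_mono] assms(5) unfolding same_order_def by blast
  define b where "b k = d k powr (- \<alpha>) / real k" for k
  interpret hazard_rate b "2 * K powr \<alpha>"
  proof
    fix k :: nat assume k: "1 \<le> k"
    show "0 < b k"
      using d_pos[OF k] k by (simp add: b_def)
    have "d k powr (- \<alpha>) = K powr \<alpha> * (K * d k) powr (- \<alpha>)"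
      using K(1) d_pos[OF k] by (simp add: powr_mult powr_minus)
    also have "\<dots> \<le> K powr \<alpha> * d (2 * k) powr (- \<alpha>)"
      using K k d_pos[of "2 * k"] \<alpha> by (intro mult_left_mono powr_mono2') auto
    finally show "b k \<le> 2 * K powr \<alpha> * b (2 * k)"
      using k by (simp add: b_def field_simps)
  next
    fix j k :: nat assume "1 \<le> j" "j \<le> k"
    then show "real k * b k \<le> real j * b j"
      using d_pos[of j] mono_onD[OF d_mono, of j k] \<alpha> by (simp add: b_def powr_mono2')
  qed
  let ?f = "\<lambda>k. b k * survival b k"
  interpret w: regular_weight ?f "2 * K powr \<alpha> * exp (b 1)"
    by (rule regular_weight_survival)
  obtain P :: "nat pmf" where P: "\<And>i. pmf P i = ?f (Suc i)"
    using survival_pmf assms(6) unfolding b_def by blast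
  let ?\<sigma> = "measure_pmf P"
  let ?eu = "entropy_number (ell p) (ell_norm p) (Lspace \<alpha> ?\<sigma>) (Lspace_norm \<alpha> ?\<sigma>) embedding"
  obtain C n0 where C: "0 < C"
    and eu: "\<And>n. n0 \<le> n \<Longrightarrow> ?eu n \<le> ereal (C * ?f n powr (1 / \<alpha>) * real n powr (1 / \<alpha> - 1 / p))"
    by (rule w.entropy_number_embedding_le[OF \<alpha> p P], rule that)
  define N where "N n = 4 * n" for n :: nat
  \<comment> \<open>\<open>M n\<close> draws, each new with probability at least \<open>survival b (4 * n)\<close>, give \<open>16 * n\<close> expected
    successes, four times the required number of values.\<close>
  define M where "M n = nat \<lceil>16 * real n / survival b (4 * n)\<rceil>" for n
  have anti: "antimono (pmf P)"
    unfolding P by (intro antimonoI w.antitone) auto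
  have M_ge: "16 * real n / survival b (4 * n) \<le> real (M n)" for n
    unfolding M_def by linarith
  have tail: "1 - (\<Sum>i<N n. pmf P i) = survival b (4 * n)" for n
    unfolding P sum_survival by (simp add: N_def)
  have many: "4 * real (N n) \<le> real (M n) * (1 - (\<Sum>i<N n. pmf P i))" for n
    using M_ge[of n] survival_pos[of "4 * n"] unfolding tail by (simp add: N_def field_simps)
  have n_le_M: "n \<le> M n" for n
  proof -
    have "real n \<le> 16 * real n / survival b (4 * n)"
      using survival_pos[of "4 * n"] survival_le_one[of "4 * n"] mult_left_mono[of "survival b (4 * n)" 1 "real n"]
      by (simp add: field_simps)
    with M_ge[of n] show ?thesis by linarith
  qed
  \<comment> \<open>\<open>68 = 4 * (16 + 1)\<close>, with 1 for the rounding in \<open>M n\<close>; the square accounts for two doublings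
    from \<open>n\<close> to \<open>4 * n\<close>\<close>
  define D where "D = 68 * exp (b 1) ^ 2"
  have D: "0 < D"
    by (simp add: D_def)
  have M_le: "4 * real (M n) \<le> D * real n / survival b n" if n: "1 \<le> n" for n
  proof -
    let ?T = "survival b (4 * n)"
    have "1 \<le> real n / ?T"
      using n survival_pos[of "4 * n"] survival_le_one[of "4 * n"] by (simp add: field_simps)
    moreover have "real (M n) \<le> 16 * real n / ?T + 1"
      unfolding M_def using survival_pos[of "4 * n"] by (simp add: of_nat_nat)
    ultimately have "4 * real (M n) \<le> 68 * (real n / ?T)"
      by simp
    also have "\<dots> \<le> 68 * (real n * (exp (b 1) ^ 2 / survival b n))"
    proof -
      have "survival b n \<le> exp (b 1) * survival b (2 * n)"
        using n by (rule survival_doubling)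
      also have "\<dots> \<le> exp (b 1) * (exp (b 1) * survival b (2 * (2 * n)))"
        using survival_doubling[of "2 * n"] n by (intro mult_left_mono) auto
      finally have "survival b n \<le> exp (b 1) ^ 2 * ?T"
        by (simp add: power2_eq_square mult.assoc)
      then have "1 / ?T \<le> exp (b 1) ^ 2 / survival b n"
        using survival_pos by (simp add: field_simps)
      then have "real n * (1 / ?T) \<le> real n * (exp (b 1) ^ 2 / survival b n)"
        by (intro mult_left_mono) auto
      then show ?thesis by simp
    qed
    finally show ?thesis by (simp add: D_def ac_simps)
  qed
  define c where "c = c_stable \<alpha> * D powr (- 1 / \<alpha>) / 4 * 4 powr (- 1 / p)"
  have c: "0 < c"
    using c_stable_pos[OF \<alpha>] D by (simp add: c_def)
  have gap: "ereal (c / C * d n) \<le> entropy_gap \<alpha> (ell p) (ell_norm p) ?\<sigma> embedding V \<zeta> n \<omega>"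
    if n: "1 \<le> n" "n0 \<le> n" and distinct: "N n \<le> card ((\<lambda>j. V j \<omega>) ` {..<M n})"
      and \<zeta>: "\<And>j. 0 < \<zeta> j \<omega>" "(\<Sum>i<M n. \<zeta> i \<omega>) \<le> 4 * real (M n)"
    for V :: "nat \<Rightarrow> 'w \<Rightarrow> nat" and \<zeta> \<omega> n
  proof -
    let ?ev = "entropy_number (ell p) (ell_norm p) (ell 2) (ell_norm 2) (random_operator \<alpha> ?\<sigma> embedding V \<zeta> \<omega>) n"
    \<comment> \<open>the common part of both entropy numbers; their quotient then only depends on constants
      and on the factor \<open>1 / d n\<close> contained in the masses\<close>
    define W where "W = survival b n powr (1 / \<alpha>) * (real n powr (- 1 / \<alpha>) * real n powr (- 1 / p) * real n powr (1 / 2))"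
    have W: "0 < W"
      using n survival_pos[of n] by (simp add: W_def)
    have "c * W = c_stable \<alpha> * (D * real n / survival b n) powr (- 1 / \<alpha>) / 4 * (4 * real n) powr (- 1 / p) * real n powr (1 / 2)"
      using survival_pos[of n] by (simp add: c_def W_def powr_mult powr_divide powr_minus field_simps)
    also have "\<dots> \<le> c_stable \<alpha> * (4 * real (M n)) powr (- 1 / \<alpha>) / 4 * (4 * real n) powr (- 1 / p) * real n powr (1 / 2)"
      using M_le[OF n(1)] n_le_M[of n] n \<alpha> c_stable_pos[OF \<alpha>]
      by (intro mult_right_mono divide_right_mono mult_left_mono powr_mono2') auto
    finally have "ereal (c * W) \<le> ereal (c_stable \<alpha> * (4 * real (M n)) powr (- 1 / \<alpha>) / 4 * (4 * real n) powr (- 1 / p) * real n powr (1 / 2))"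
      by simp
    also have "\<dots> \<le> ?ev"
      using \<alpha> p n distinct \<zeta>
      by (intro random_operator_entropy_ge) (auto simp: N_def measure_pmf.prob_space_axioms)
    finally have num: "ereal (c * W) \<le> ?ev" .
    have "?f n powr (1 / \<alpha>) = survival b n powr (1 / \<alpha>) * real n powr (- 1 / \<alpha>) / d n"
      using n \<alpha> d_pos[OF n(1)]
      by (simp add: b_def powr_mult powr_divide powr_powr powr_minus field_simps)
    moreover have "real n powr (1 / \<alpha> - 1 / p) = real n powr (1 / \<alpha>) * real n powr (- 1 / p)"
      by (simp add: powr_diff powr_minus field_simps)
    moreover have "real n powr (- 1 / \<alpha> + 1 / 2) = real n powr (- 1 / \<alpha>) * real n powr (1 / 2)"
      by (rule powr_add)
    moreover have "real n powr (- 1 / \<alpha>) * real n powr (1 / \<alpha>) = 1"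
      using n by (simp add: powr_minus)
    ultimately have "real n powr (- 1 / \<alpha> + 1 / 2) * (C * ?f n powr (1 / \<alpha>) * real n powr (1 / \<alpha> - 1 / p)) = C * W / d n"
      by (simp add: W_def)
    then have den: "ereal (real n powr (- 1 / \<alpha> + 1 / 2)) * ?eu n \<le> ereal (C * W / d n)"
      using ereal_mult_left_mono[OF eu[OF n(2)], of "ereal (real n powr (- 1 / \<alpha> + 1 / 2))"] by simp
    have "ereal (c * W / (C * W / d n)) \<le> ?ev / (ereal (real n powr (- 1 / \<alpha> + 1 / 2)) * ?eu n)"
      using num den c C W d_pos[OF n(1)]
      by (intro ereal_divide_ge) (auto intro!: ereal_0_le_mult entropy_number_nonneg)
    also have "c * W / (C * W / d n) = c / C * d n"
      using W by simp
    finally show ?thesis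
      by (simp add: entropy_gap_def)
  qed
  have "AE \<omega> in Q. (\<lambda>n. ereal (d n)) \<preceq> (\<lambda>n. entropy_gap \<alpha> (ell p) (ell_norm p) ?\<sigma> embedding V \<zeta> n \<omega>)"
    if model: "random_model ?\<sigma> Q V \<zeta>" for Q :: "'w measure" and V \<zeta>
  proof -
    interpret prob_space Q
      using model by (simp add: random_model_def)
    have ind: "indep_vars (\<lambda>_. borel) \<zeta> UNIV"
      and exp: "\<And>j. distributed Q lborel (\<zeta> j) (\<lambda>x. ennreal (exponential_density 1 x))"
      using model by (simp_all add: random_model_def)
    have "AE \<omega> in Q. \<forall>\<^sub>F n in sequentially. N n \<le> card ((\<lambda>j. V j \<omega>) ` {..<M n})"
      using random_model_AE_fst[OF model AE_many_values[OF anti _ many]] by (simp add: N_def)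
    moreover have "AE \<omega> in Q. \<forall>\<^sub>F n in sequentially. (\<Sum>i<n. \<zeta> i \<omega>) \<le> 4 * real n"
      by (rule AE_sum_exponential_le[OF ind exp])
    moreover have "AE \<omega> in Q. \<forall>j. 0 < \<zeta> j \<omega>"
      using AE_exponential_pos[OF exp] by (simp add: AE_all_countable)
    ultimately show ?thesis
    proof eventually_elim
      case (elim \<omega>)
      have "filterlim M at_top sequentially"
        by (rule filterlim_at_top_mono[OF filterlim_ident]) (simp add: n_le_M)
      from eventually_compose_filterlim[OF elim(2) this]
      have "\<forall>\<^sub>F n in sequentially. (\<Sum>i<M n. \<zeta> i \<omega>) \<le> 4 * real (M n)" .
      with elim(1) eventually_ge_at_top[of 1] eventually_ge_at_top[of n0]
      have "\<forall>\<^sub>F n in sequentially. 0 < d n \<and>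
          ereal (c / C * d n) \<le> entropy_gap \<alpha> (ell p) (ell_norm p) ?\<sigma> embedding V \<zeta> n \<omega>"
        by eventually_elim (use gap d_pos elim(3) in auto)
      then show ?case
        using c C by (intro preceqI[of "c / C"]) auto
    qed
  qed
  then show ?thesis
    by (intro exI[of _ ?\<sigma>]) (auto intro: measure_pmf.prob_space_axioms)
qed

end
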